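(* Let $d=n$ and $\omega=(1^n)=(1,\dots,1)\in\Lambda(n,n)$. The algebra $1_\omega\mathbf{S}(n,n)1_\omega$, which is isomorphic with the Hecke algebra $\mathbf{H}(\Sigma_n)$ over $\mathbb{Q}(v)$, is generated by the elements $t_i=1_\omega E_iF_i1_\omega$ ($1\le i\le n-1$), and it is presented (as an associative algebra with identity $1_\omega$) by these generators with the relations (H1) $t_i^2=[2]\,t_i$; (H2) $t_it_j=t_jt_i$ for $|i-j|>1$; (H3) $t_it_{i+1}t_i-t_{i+1}t_it_{i+1}=t_i-t_{i+1}$.
   Context: $n\ge1$ is an integer, $v$ an indeterminate, $[m]=(v^m-v^{-m})/(v-v^{-1})$, so $[2]=v+v^{-1}$. $\varepsilon_1,\dots,\varepsilon_n$ is the standard orthonormal basis of $\mathbb{R}^n$, $\alpha_i=\varepsilon_i-\varepsilon_{i+1}$. $\mathbf{U}=\mathbf{U}(\mathfrak{gl}_n)$ is the $\mathbb{Q}(v)$-algebra with generators $E_i,F_i$ ($1\le i\le n-1$), $K_i^{\pm1}$ ($1\le i\le n$) and relations: $K_iK_j=K_jK_i$, $K_iK_i^{-1}=K_i^{-1}K_i=1$; $E_iF_j-F_jE_i=\delta_{ij}(K_iK_{i+1}^{-1}-K_i^{-1}K_{i+1})/(v-v^{-1})$; $K_iE_j=v^{(\varepsilon_i,\alpha_j)}E_jK_i$, $K_iF_j=v^{-(\varepsilon_i,\alpha_j)}F_jK_i$; $E_i^2E_j-(v+v^{-1})E_iE_jE_i+E_jE_i^2=0$ for $|i-j|=1$,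 $E_iE_j=E_jE_i$ otherwise; and the same two relations with $F$ in place of $E$. $\mathbf{V}$ is the natural module with basis $w_1,\dots,w_n$: $K_iw_j=v^{\delta_{ij}}w_j$, $E_iw_j=\delta_{j,i+1}w_i$, $F_iw_j=\delta_{ij}w_{i+1}$; $\mathbf{U}$ acts on $\mathbf{V}^{\otimes d}$ through a standard comultiplication, e.g. $\Delta(K_i)=K_i\otimes K_i$, $\Delta(E_i)=E_i\otimes K_iK_{i+1}^{-1}+1\otimes E_i$, $\Delta(F_i)=F_i\otimes1+K_i^{-1}K_{i+1}\otimes F_i$. $\mathbf{S}(n,d)$ is the image of $\mathbf{U}\to\operatorname{End}(\mathbf{V}^{\otimes d})$; images are denoted by the same symbols. $\Lambda(n,d)=\{\lambda\in\mathbb{N}^n\mid\sum\lambda_i=d\}$ and $1_\lambda=\prod_{i=1}^n\begin{bmatrix}K_i\\\lambda_i\end{bmatrix}$ with $\begin{bmatrix}K_i\\t\end{bmatrix}=\prod_{s=1}^t\frac{K_iv^{-s+1}-K_i^{-1}v^{s-1}}{v^s-v^{-s}}$, $\begin{bmatrix}K_i\\0\end{bmatrix}=1$; thus $1_\omega=\prod_{i=1}^n\frac{K_i-K_i^{-1}}{v-v^{-1}}$, an idempotent of $\mathbf{S}(n,n)$. The Hecke algebra $\mathbf{H}(\Sigma_n)$ is the $\mathbb{Q}(v)$-algebra with generators $T_i$ ($1\le i\le n-1$) and relations $T_i^2=(q-1)T_i+q$, $T_iT_j=T_jT_i$ ($|i-j|>1$), $T_iT_{i+1}T_i=T_{i+1}T_iT_{i+1}$,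 where $q=v^2$ (with $T_i=v^2-vt_i$). *)

theory Defs
  imports
    "HOL-Algebra.QuotRing"
    "HOL-Algebra.Module"
    "HOL-Computational_Algebra.Polynomial"
    "HOL-Computational_Algebra.Fraction_Field"
    "HOL-Library.Poly_Mapping"
    "Jordan_Normal_Form.Matrix"
begin

section \<open>Associative algebras\<close>

text \<open>An associative unital \<open>'k\<close>-algebra is a record of type \<open>('k, 'a) module\<close>, whose ring
  part need not be commutative; the scalars are all elements of the type \<open>'k\<close>. (The locale
  \<open>algebra\<close> of HOL-Algebra is restricted to commutative algebras.)\<close>

definition alg_hom :: "('k, 'a) module \<Rightarrow> ('k, 'b) module \<Rightarrow> ('a \<Rightarrow> 'b) set" where
  "alg_hom A B =
     {f \<in> Ring.ring_hom A B. \<forall>c. \<forall>x \<in> carrier A. f (c \<odot>\<^bsub>A\<^esub> x) = c \<odot>\<^bsub>B\<^esub> f x}"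

definition alg_iso :: "('k, 'a) module \<Rightarrow> ('k, 'b) module \<Rightarrow> ('a \<Rightarrow> 'b) set" where
  "alg_iso A B = {f \<in> alg_hom A B. bij_betw f (carrier A) (carrier B)}"

inductive_set alg_generate :: "('k, 'a) module \<Rightarrow> 'a set \<Rightarrow> 'a set"
  for A :: "('k, 'a) module" and S :: "'a set" where
  one: "\<one>\<^bsub>A\<^esub> \<in> alg_generate A S"
| incl: "x \<in> S \<Longrightarrow> x \<in> alg_generate A S"
| add: "x \<in> alg_generate A S \<Longrightarrow> y \<in> alg_generate A S \<Longrightarrow> x \<oplus>\<^bsub>A\<^esub> y \<in> alg_generate A S"
| mult: "x \<in> alg_generate A S \<Longrightarrow> y \<in> alg_generate A S \<Longrightarrow> x \<otimes>\<^bsub>A\<^esub> y \<in> alg_generate A S"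
| smult: "x \<in> alg_generate A S \<Longrightarrow> c \<odot>\<^bsub>A\<^esub> x \<in> alg_generate A S"

definition corner :: "('k, 'a) module \<Rightarrow> 'a \<Rightarrow> ('k, 'a) module" where
  "corner A e = A\<lparr>carrier := {e \<otimes>\<^bsub>A\<^esub> x \<otimes>\<^bsub>A\<^esub> e | x. x \<in> carrier A}, one := e\<rparr>"

definition ordered_prod :: "('k, 'a) module \<Rightarrow> 'a list \<Rightarrow> 'a" where
  "ordered_prod A xs = foldr (\<lambda>x y. x \<otimes>\<^bsub>A\<^esub> y) xs \<one>\<^bsub>A\<^esub>"


section \<open>Free algebras and presentations\<close>

text \<open>Words form a monoid under concatenation; with this instance the product of
  \<open>'x list \<Rightarrow>\<^sub>0 'k\<close> is the product of the free associative algebra.\<close>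

instantiation list :: (type) monoid_add
begin
definition zero_list :: "'a list" where "zero_list = []"
definition plus_list :: "'a list \<Rightarrow> 'a list \<Rightarrow> 'a list" where "plus_list xs ys = xs @ ys"
instance by standard (simp_all add: zero_list_def plus_list_def)
end

abbreviation fscale :: "'k::ring_1 \<Rightarrow> ('x list \<Rightarrow>\<^sub>0 'k) \<Rightarrow> ('x list \<Rightarrow>\<^sub>0 'k)" where
  "fscale c p \<equiv> Poly_Mapping.map (\<lambda>a. c * a) p"

abbreviation fvar :: "'x \<Rightarrow> ('x list \<Rightarrow>\<^sub>0 'k::ring_1)" where
  "fvar x \<equiv> Poly_Mapping.single [x] 1"

definition free_alg :: "'x set \<Rightarrow> ('k::ring_1, 'x list \<Rightarrow>\<^sub>0 'k) module" where
  "free_alg X = \<lparr>carrier = {p. Poly_Mapping.keys p \<subseteq> lists X}, monoid.mult = (*), one = 1,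
     zero = 0, add = (+), smult = fscale\<rparr>"

definition quot_alg :: "('k, 'a) module \<Rightarrow> 'a set \<Rightarrow> ('k, 'a set) module" where
  "quot_alg A I = \<lparr>carrier = carrier (A Quot I),
     monoid.mult = monoid.mult (A Quot I), one = one (A Quot I),
     zero = zero (A Quot I), add = add (A Quot I),
     smult = (\<lambda>c X. \<Union>x\<in>X. I +>\<^bsub>A\<^esub> (c \<odot>\<^bsub>A\<^esub> x))\<rparr>"

text \<open>The algebra with generators \<open>X\<close> and relations \<open>r = 0\<close> for \<open>r \<in> R\<close>, and the class in it
  of a generator. \<open>genideal\<close> is the two-sided ideal generated by a set.\<close>

definition presented_alg ::
    "'x set \<Rightarrow> ('x list \<Rightarrow>\<^sub>0 'k::ring_1) set \<Rightarrow> ('k, ('x list \<Rightarrow>\<^sub>0 'k) set) module" where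
  "presented_alg X R = quot_alg (free_alg X) (genideal (free_alg X) R)"

definition presented_gen ::
    "'x set \<Rightarrow> ('x list \<Rightarrow>\<^sub>0 'k::ring_1) set \<Rightarrow> 'x \<Rightarrow> ('x list \<Rightarrow>\<^sub>0 'k) set" where
  "presented_gen X R x = genideal (free_alg X) R +>\<^bsub>free_alg X\<^esub> fvar x"

text \<open>Evaluation of a noncommutative polynomial at an assignment \<open>g\<close> of the generators.\<close>

definition free_eval :: "('k::ring_1, 'a) module \<Rightarrow> ('x \<Rightarrow> 'a) \<Rightarrow> ('x list \<Rightarrow>\<^sub>0 'k) \<Rightarrow> 'a" where
  "free_eval A g p =
     (\<Oplus>\<^bsub>A\<^esub>w\<in>Poly_Mapping.keys p. Poly_Mapping.lookup p w \<odot>\<^bsub>A\<^esub> ordered_prod A (map g w))"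


section \<open>The field \<open>\<rat>(v)\<close>\<close>

type_synonym ratv = "rat poly fract"

definition v :: ratv where
  "v = Fract [:0, 1:] 1"

definition qint :: "int \<Rightarrow> ratv" where
  "qint m = (v powi m - v powi (- m)) / (v - v powi (- 1))"


section \<open>The quantized enveloping algebra of \<open>gl\<^sub>n\<close>\<close>

datatype ugen = E nat | F nat | K nat | Kinv nat

definition ugens :: "nat \<Rightarrow> ugen set" where
  "ugens n = E ` {1..<n} \<union> F ` {1..<n} \<union> K ` {1..n} \<union> Kinv ` {1..n}"

definition eps :: "nat \<Rightarrow> nat \<Rightarrow> int" where
  "eps i = (\<lambda>k. if k = i then 1 else 0)"

definition simple_root :: "nat \<Rightarrow> nat \<Rightarrow> int" where
  "simple_root i = (\<lambda>k. eps i k - eps (i + 1) k)"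

definition pairing :: "nat \<Rightarrow> (nat \<Rightarrow> int) \<Rightarrow> (nat \<Rightarrow> int) \<Rightarrow> int" where
  "pairing n x y = (\<Sum>k = 1..n. x k * y k)"

definition serre_rels :: "nat \<Rightarrow> (nat \<Rightarrow> ugen) \<Rightarrow> (ugen list \<Rightarrow>\<^sub>0 ratv) set" where
  "serre_rels n X =
     {fvar (X i) * fvar (X i) * fvar (X j)
        - fscale (v + v powi (- 1)) (fvar (X i) * fvar (X j) * fvar (X i))
        + fvar (X j) * fvar (X i) * fvar (X i)
      | i j. i \<in> {1..<n} \<and> j \<in> {1..<n} \<and> \<bar>int i - int j\<bar> = 1}
   \<union> {fvar (X i) * fvar (X j) - fvar (X j) * fvar (X i)
      | i j. i \<in> {1..<n} \<and> j \<in> {1..<n} \<and> \<bar>int i - int j\<bar> \<noteq> 1}"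

definition urels :: "nat \<Rightarrow> (ugen list \<Rightarrow>\<^sub>0 ratv) set" where
  "urels n =
     {fvar (K i) * fvar (K j) - fvar (K j) * fvar (K i) | i j. i \<in> {1..n} \<and> j \<in> {1..n}}
   \<union> {fvar (K i) * fvar (Kinv i) - 1 | i. i \<in> {1..n}}
   \<union> {fvar (Kinv i) * fvar (K i) - 1 | i. i \<in> {1..n}}
   \<union> {fvar (E i) * fvar (F j) - fvar (F j) * fvar (E i)
        - (if i = j then
             fscale (1 / (v - v powi (- 1)))
               (fvar (K i) * fvar (Kinv (i + 1)) - fvar (Kinv i) * fvar (K (i + 1)))
           else 0)
      | i j. i \<in> {1..<n} \<and> j \<in> {1..<n}}
   \<union> {fvar (K i) * fvar (E j)
        - fscale (v powi (pairing n (eps i) (simple_root j))) (fvar (E j) * fvar (K i))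
      | i j. i \<in> {1..n} \<and> j \<in> {1..<n}}
   \<union> {fvar (K i) * fvar (F j)
        - fscale (v powi (- pairing n (eps i) (simple_root j))) (fvar (F j) * fvar (K i))
      | i j. i \<in> {1..n} \<and> j \<in> {1..<n}}
   \<union> serre_rels n E \<union> serre_rels n F"

definition U :: "nat \<Rightarrow> (ratv, (ugen list \<Rightarrow>\<^sub>0 ratv) set) module" where
  "U n = presented_alg (ugens n) (urels n)"

definition ugen_class :: "nat \<Rightarrow> ugen \<Rightarrow> (ugen list \<Rightarrow>\<^sub>0 ratv) set" where
  "ugen_class n = presented_gen (ugens n) (urels n)"


section \<open>Tensor powers of the natural module\<close>

text \<open>\<open>End(V)\<close> is the algebra of \<open>n \<times> n\<close> matrices relative to \<open>w\<^sub>1, \<dots>, w\<^sub>n\<close>. Matrix indices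
  start at 0: the entry at \<open>(a - 1, b - 1)\<close> is the coefficient of \<open>w\<^sub>a\<close> in the image of \<open>w\<^sub>b\<close>.\<close>

definition mat1 :: "nat \<Rightarrow> (nat \<Rightarrow> nat \<Rightarrow> ratv) \<Rightarrow> ratv mat" where
  "mat1 n f = mat n n (\<lambda>(r, c). f (r + 1) (c + 1))"

fun nat_rep :: "nat \<Rightarrow> ugen \<Rightarrow> ratv mat" where
  "nat_rep n (E i) = mat1 n (\<lambda>a b. if b = i + 1 \<and> a = i then 1 else 0)"
| "nat_rep n (F i) = mat1 n (\<lambda>a b. if b = i \<and> a = i + 1 then 1 else 0)"
| "nat_rep n (K i) = mat1 n (\<lambda>a b. if a = b then (if i = b then v else 1) else 0)"
| "nat_rep n (Kinv i) = mat1 n (\<lambda>a b. if a = b then (if i = b then v powi (- 1) else 1) else 0)"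

text \<open>Kronecker product, i.e. the tensor product of two linear maps relative to the
  lexicographically ordered product basis.\<close>

definition kron :: "ratv mat \<Rightarrow> ratv mat \<Rightarrow> ratv mat" where
  "kron A B = mat (dim_row A * dim_row B) (dim_col A * dim_col B)
     (\<lambda>(r, c). A $$ (r div dim_row B, c div dim_col B) * B $$ (r mod dim_row B, c mod dim_col B))"

text \<open>The action on \<open>V\<close> to the power \<open>d + 1\<close>, taken as \<open>V\<close> tensor \<open>V\<close> to the power \<open>d\<close>, through
  \<open>\<Delta>(E i) = E i \<otimes> K i Kinv (i+1) + 1 \<otimes> E i\<close>,
  \<open>\<Delta>(F i) = F i \<otimes> 1 + Kinv i K (i+1) \<otimes> F i\<close>, \<open>\<Delta>(K i) = K i \<otimes> K i\<close>; for \<open>d = 0\<close> it is the counit.\<close>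

fun tens_rep :: "nat \<Rightarrow> nat \<Rightarrow> ugen \<Rightarrow> ratv mat" where
  "tens_rep n 0 (E i) = 0\<^sub>m 1 1"
| "tens_rep n 0 (F i) = 0\<^sub>m 1 1"
| "tens_rep n 0 (K i) = 1\<^sub>m 1"
| "tens_rep n 0 (Kinv i) = 1\<^sub>m 1"
| "tens_rep n (Suc d) (E i) =
     kron (nat_rep n (E i)) (tens_rep n d (K i) * tens_rep n d (Kinv (i + 1)))
     + kron (1\<^sub>m n) (tens_rep n d (E i))"
| "tens_rep n (Suc d) (F i) =
     kron (nat_rep n (F i)) (1\<^sub>m (n ^ d))
     + kron (nat_rep n (Kinv i) * nat_rep n (K (i + 1))) (tens_rep n d (F i))"
| "tens_rep n (Suc d) (K i) = kron (nat_rep n (K i)) (tens_rep n d (K i))"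
| "tens_rep n (Suc d) (Kinv i) = kron (nat_rep n (Kinv i)) (tens_rep n d (Kinv i))"

definition End_tens :: "nat \<Rightarrow> nat \<Rightarrow> (ratv, ratv mat) module" where
  "End_tens n d = module_mat TYPE(ratv) (n ^ d) (n ^ d)"

text \<open>The homomorphism from \<open>U(gl\<^sub>n)\<close> induced on cosets by evaluation, in the style of the first
  isomorphism theorem \<open>ring_hom_ring.FactRing_iso\<close>.\<close>

definition U_rep :: "nat \<Rightarrow> nat \<Rightarrow> (ugen list \<Rightarrow>\<^sub>0 ratv) set \<Rightarrow> ratv mat" where
  "U_rep n d X = the_elem (free_eval (End_tens n d) (tens_rep n d) ` X)"

definition Schur :: "nat \<Rightarrow> nat \<Rightarrow> (ratv, ratv mat) module" where
  "Schur n d = (End_tens n d)\<lparr>carrier := U_rep n d ` carrier (U n)\<rparr>"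


section \<open>Weight idempotents and the elements \<open>t\<^sub>i\<close>\<close>

definition Kbinom :: "nat \<Rightarrow> nat \<Rightarrow> nat \<Rightarrow> (ugen list \<Rightarrow>\<^sub>0 ratv) set" where
  "Kbinom n i t = ordered_prod (U n)
     (map (\<lambda>s. (1 / (v powi int s - v powi (- int s))) \<odot>\<^bsub>U n\<^esub>
                 ((v powi (- int s + 1)) \<odot>\<^bsub>U n\<^esub> ugen_class n (K i)
                   \<ominus>\<^bsub>U n\<^esub> (v powi (int s - 1)) \<odot>\<^bsub>U n\<^esub> ugen_class n (Kinv i)))
          [1..<Suc t])"

definition wt_elem :: "nat \<Rightarrow> (nat \<Rightarrow> nat) \<Rightarrow> (ugen list \<Rightarrow>\<^sub>0 ratv) set" where
  "wt_elem n lam = ordered_prod (U n) (map (\<lambda>i. Kbinom n i (lam i)) [1..<Suc n])"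

definition omega :: "nat \<Rightarrow> nat" where
  "omega = (\<lambda>_. 1)"

text \<open>\<open>1\<^sub>\<omega>\<close> and the \<open>t\<^sub>i\<close> as elements of \<open>S(n,n)\<close>.\<close>

definition one_omega :: "nat \<Rightarrow> ratv mat" where
  "one_omega n = U_rep n n (wt_elem n omega)"

definition tgen :: "nat \<Rightarrow> nat \<Rightarrow> ratv mat" where
  "tgen n i = one_omega n \<otimes>\<^bsub>Schur n n\<^esub> U_rep n n (ugen_class n (E i))
     \<otimes>\<^bsub>Schur n n\<^esub> U_rep n n (ugen_class n (F i)) \<otimes>\<^bsub>Schur n n\<^esub> one_omega n"

definition corner_Schur :: "nat \<Rightarrow> (ratv, ratv mat) module" where
  "corner_Schur n = corner (Schur n n) (one_omega n)"


section \<open>The Hecke algebra and the relations for the \<open>t\<^sub>i\<close>\<close>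

definition hecke_rels :: "nat \<Rightarrow> (nat list \<Rightarrow>\<^sub>0 ratv) set" where
  "hecke_rels n = (let q = v ^ 2 in
     {fvar i * fvar i - (fscale (q - 1) (fvar i) + fscale q 1) | i. i \<in> {1..<n}}
   \<union> {fvar i * fvar j - fvar j * fvar i
      | i j. i \<in> {1..<n} \<and> j \<in> {1..<n} \<and> \<bar>int i - int j\<bar> > 1}
   \<union> {fvar i * fvar (i + 1) * fvar i - fvar (i + 1) * fvar i * fvar (i + 1)
      | i. i \<in> {1..<n} \<and> i + 1 \<in> {1..<n}})"

definition Hecke :: "nat \<Rightarrow> (ratv, (nat list \<Rightarrow>\<^sub>0 ratv) set) module" where
  "Hecke n = presented_alg {1..<n} (hecke_rels n)"

definition hecke_gen :: "nat \<Rightarrow> nat \<Rightarrow> (nat list \<Rightarrow>\<^sub>0 ratv) set" where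
  "hecke_gen n = presented_gen {1..<n} (hecke_rels n)"

definition H_rels :: "nat \<Rightarrow> (nat list \<Rightarrow>\<^sub>0 ratv) set" where
  "H_rels n =
     {fvar i * fvar i - fscale (qint 2) (fvar i) | i. i \<in> {1..<n}}
   \<union> {fvar i * fvar j - fvar j * fvar i
      | i j. i \<in> {1..<n} \<and> j \<in> {1..<n} \<and> \<bar>int i - int j\<bar> > 1}
   \<union> {fvar i * fvar (i + 1) * fvar i - fvar (i + 1) * fvar i * fvar (i + 1)
        - (fvar i - fvar (i + 1))
      | i. i \<in> {1..<n} \<and> i + 1 \<in> {1..<n}}"

end

(* The generators of U act on the coefficient functions of tensors. The space of weight omega has the
   n! words without repetition as a basis, and t_i acts on it by (t_i f)(w) = c f(w) + f(s_i w), where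
   s_i exchanges the letters i and i+1 and c is 1/v if i stands to the left of i+1 and v otherwise.
   This gives the relations. Hecke operators on the positions of a word commute with U, so an element of
   the corner algebra is determined by its value at the word 1 2 ... n. The t_i generate the whole space
   from this word, hence they generate the corner algebra. The relations reduce every monomial in the
   generators to a combination of n! normal words, and n! operators that span a space of dimension n!
   from one vector are linearly independent. The same argument, with other coefficients, applies to
   T_i = v^2 - v t_i. *)
theory Submission
  imports Defs "Jordan_Normal_Form.Determinant" "HOL-Combinatorics.Multiset_Permutations"
begin

section \<open>The parameter \<open>v\<close>\<close>

text \<open>Both presentations are instances of one. On the pair of basis vectors of w and s_i w
  each of t_i and T_i is a symmetric 2x2 matrix with diagonal entries c1, c2 and off-diagonal entry
  b, where c1 belongs to the word with i left of i+1. Cayley-Hamilton gives the quadratic relation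
  with coefficients c1 + c2 and b^2 - c1 c2, and the defect in the braid relation is c1 c2 times the
  difference of the two generators. For t_i the triple (c1, c2, b) is (1/v, v, 1), so b^2 = c1 c2 =
  1 and c1 + c2 = [2]; for T_i = v^2 - v t_i it is (v^2 - 1, 0, -v), so the braid defect vanishes.
  The common argument asks only for b \<noteq> 0 and for the operators to lie in the corner algebra.
  U consists of cosets and S(n,n) is an image, so neither offers a basis to start from. Elements are
  therefore represented by noncommutative polynomials and compared through their action on
  coefficient functions; matrices enter only when an operator is restricted to words of a fixed
  length.\<close>

lemma v_neq_0 [simp]: "v \<noteq> 0"
  unfolding v_def by (simp add: Zero_fract_def eq_fract)

lemma v_square_neq_1: "v * v \<noteq> 1"
  unfolding v_def by (simp add: One_fract_def eq_fract one_pCons)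

lemma v_minus_inverse_neq_0 [simp]: "v - inverse v \<noteq> 0"
  using v_square_neq_1 by (simp add: field_simps)

lemma qint_2: "qint 2 = v + inverse v"
  using v_square_neq_1 v_minus_inverse_neq_0
  unfolding qint_def by (simp add: power_int_minus field_simps power2_eq_square)


section \<open>Generators of \<open>U\<close> as operators on functions of words\<close>

text \<open>A function \<open>f\<close> on words of length \<open>d\<close> stands for the vector of coefficients of the tensor
  \<open>\<Sum> f [a\<^sub>1, \<dots>, a\<^sub>d] w\<^sub>a\<^sub>1 \<otimes> \<dots> \<otimes> w\<^sub>a\<^sub>d\<close>. Treating all lengths and all letters at once costs
  nothing, and makes the relations of \<open>U\<close> identities that are proved by induction on the word.\<close>

type_synonym oper = "(nat list \<Rightarrow> ratv) \<Rightarrow> nat list \<Rightarrow> ratv"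

definition wt :: "(nat \<Rightarrow> ratv) \<Rightarrow> nat list \<Rightarrow> ratv" where
  "wt mu w = prod_list (map mu w)"

lemma wt_simps [simp]: "wt mu [] = 1" "wt mu (a # w) = mu a * wt mu w"
  "wt mu (w @ u) = wt mu w * wt mu u"
  by (simp_all add: wt_def)

lemma wt_mult: "wt mu w * wt nu w = wt (\<lambda>a. mu a * nu a) w"
  by (induction w) (simp_all add: algebra_simps)

text \<open>The eigenvalue of K_i K_(i+1)^-1 on the basis vector w_a.\<close>

definition root_wt :: "nat \<Rightarrow> nat \<Rightarrow> ratv" where
  "root_wt i a = (if a = i then v else if a = Suc i then inverse v else 1)"

lemma root_wt_neq_0 [simp]: "root_wt i a \<noteq> 0"
  by (simp add: root_wt_def)

text \<open>The value at a word collects what flows into its coefficient, so a letter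
  \<open>i\<close> is traced back to \<open>Suc i\<close>, because E_i maps w_(i+1) to w_i. The
  recursion is the coproduct with V split off on the left; the weight of the tail is the factor K_i
  K_(i+1)^-1.\<close>

primrec opE :: "nat \<Rightarrow> (nat list \<Rightarrow> ratv) \<Rightarrow> nat list \<Rightarrow> ratv" where
  "opE i f [] = 0"
| "opE i f (a # w) =
     (if a = i then wt (root_wt i) w * f (Suc i # w) else 0) + opE i (\<lambda>u. f (a # u)) w"

primrec opF :: "nat \<Rightarrow> (nat list \<Rightarrow> ratv) \<Rightarrow> nat list \<Rightarrow> ratv" where
  "opF i f [] = 0"
| "opF i f (a # w) =
     (if a = Suc i then f (i # w) else 0) + inverse (root_wt i a) * opF i (\<lambda>u. f (a # u)) w"

definition opD :: "(nat \<Rightarrow> ratv) \<Rightarrow> oper" where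
  "opD mu f w = wt mu w * f w"

fun op_gen :: "ugen \<Rightarrow> oper" where
  "op_gen (E i) = opE i"
| "op_gen (F i) = opF i"
| "op_gen (K i) = opD (\<lambda>a. if a = i then v else 1)"
| "op_gen (Kinv i) = opD (\<lambda>a. if a = i then inverse v else 1)"

lemma opE_linear_at:
  "opE i (\<lambda>w. 0) w = 0"
  "opE i (\<lambda>w. f w + g w) w = opE i f w + opE i g w"
  "opE i (\<lambda>w. c * f w) w = c * opE i f w"
  by (induction w arbitrary: f g) (simp_all add: ring_distribs mult.left_commute add_ac)

lemma opE_linear:
  "opE i (\<lambda>w. 0) = (\<lambda>w. 0)"
  "opE i (\<lambda>w. f w + g w) = (\<lambda>w. opE i f w + opE i g w)"
  "opE i (\<lambda>w. c * f w) = (\<lambda>w. c * opE i f w)"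
  by (rule ext, simp only: opE_linear_at)+

lemma opF_linear_at:
  "opF i (\<lambda>w. 0) w = 0"
  "opF i (\<lambda>w. f w + g w) w = opF i f w + opF i g w"
  "opF i (\<lambda>w. c * f w) w = c * opF i f w"
  by (induction w arbitrary: f g) (simp_all add: ring_distribs mult.left_commute add_ac)

lemma opF_linear:
  "opF i (\<lambda>w. 0) = (\<lambda>w. 0)"
  "opF i (\<lambda>w. f w + g w) = (\<lambda>w. opF i f w + opF i g w)"
  "opF i (\<lambda>w. c * f w) = (\<lambda>w. c * opF i f w)"
  by (rule ext, simp only: opF_linear_at)+

text \<open>Each summand of \<open>opE i f w\<close> reads \<open>f\<close> at \<open>w\<close> with
  one letter \<open>i\<close> replaced by \<open>Suc i\<close>, which multiplies the weight by
  \<open>mu (Suc i) / mu i\<close>.\<close>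

lemma opE_wt:
  assumes "mu i \<noteq> 0"
  shows "opE i (\<lambda>w. wt mu w * f w) w = mu (Suc i) / mu i * wt mu w * opE i f w"
proof (induction w arbitrary: f)
  case (Cons a w)
  have "opE i (\<lambda>u. wt mu (a # u) * f (a # u)) w = mu a * opE i (\<lambda>u. wt mu u * f (a # u)) w"
    by (simp add: mult.assoc opE_linear)
  then show ?case
    using assms by (simp add: Cons.IH field_simps)
qed simp

lemma opF_wt:
  assumes "mu (Suc i) \<noteq> 0"
  shows "opF i (\<lambda>w. wt mu w * f w) w = mu i / mu (Suc i) * wt mu w * opF i f w"
proof (induction w arbitrary: f)
  case (Cons a w)
  have "opF i (\<lambda>u. wt mu (a # u) * f (a # u)) w = mu a * opF i (\<lambda>u. wt mu u * f (a # u)) w"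
    by (simp add: mult.assoc opF_linear)
  then show ?case
    using assms by (simp add: Cons.IH field_simps)
qed simp

text \<open>With k and W the root weights of head and tail, kW - 1/(kW) = (k - 1/k) W + (W - 1/W)/k.
  The first summand comes from E and F both acting on the head, the second is the tail term with the
  inverse root weight that \<open>opF\<close> attaches to the head.\<close>

lemma opE_opF_commutator:
  "opE i (opF j f) w - opF j (opE i f) w =
     (if i = j then (wt (root_wt i) w - wt (\<lambda>a. inverse (root_wt i a)) w) / (v - inverse v) * f w
      else 0)"
proof (induction w arbitrary: f)
  case (Cons a w)
  let ?g = "\<lambda>u. f (a # u)"
  let ?k = "root_wt i"
  have EF: "opE i (opF j f) (a # w) =
      (if a = i then wt ?k w * ((if i = j then f (i # w) else 0)
          + inverse (root_wt j (Suc i)) * opF j (\<lambda>u. f (Suc i # u)) w) else 0)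
      + (if a = Suc j then opE i (\<lambda>u. f (j # u)) w else 0)
      + inverse (root_wt j a) * opE i (opF j ?g) w"
    by (cases "a = Suc j") (auto simp: opE_linear)
  have FE: "opF j (opE i f) (a # w) =
      (if a = Suc j then (if i = j then wt ?k w * f (Suc i # w) else 0)
          + opE i (\<lambda>u. f (j # u)) w else 0)
      + inverse (root_wt j a) * ((if a = i then
          ?k j / ?k (Suc j) * wt ?k w * opF j (\<lambda>u. f (Suc i # u)) w else 0)
          + opF j (opE i ?g) w)"
    by (cases "a = i") (auto simp: opF_linear opF_wt[of "root_wt i"])
  \<comment> \<open>Symmetry of the Cartan matrix: both sides produce the factor v^(\<alpha>_i,
    \<alpha>_j), so the terms with E on the head and F on the tail cancel.\<close>
  have weight: "inverse (root_wt j (Suc i)) = inverse (root_wt j i) * (?k j / ?k (Suc j))"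
    by (auto simp: root_wt_def divide_inverse)
  have diff: "opE i (opF j f) (a # w) - opF j (opE i f) (a # w) =
      (if i = j then (if a = i then wt ?k w * f (i # w) else 0)
         - (if a = Suc i then wt ?k w * f (Suc i # w) else 0) else 0)
      + inverse (root_wt j a) * (opE i (opF j ?g) w - opF j (opE i ?g) w)"
    unfolding EF FE using weight by (auto simp: algebra_simps)
  show ?case
    unfolding diff Cons.IH using v_minus_inverse_neq_0
    by (auto simp: root_wt_def field_simps)
qed simp

lemma v_cancel: "v * (inverse v * x) = x" "inverse v * (v * x) = x"
  by (simp_all add: mult.assoc[symmetric])

lemma opE_root_wt:
  "opE i (\<lambda>w. wt (root_wt j) w * f w) w =
     (root_wt j (Suc i) * inverse (root_wt j i)) * (wt (root_wt j) w * opE i f w)"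
  by (simp add: opE_wt divide_inverse)

lemma opE_if: "opE i (\<lambda>w. if P then f w else g w) w = (if P then opE i f w else opE i g w)"
  and opF_if: "opF i (\<lambda>w. if P then f w else g w) w = (if P then opF i f w else opF i g w)"
  by simp_all

text \<open>The Serre element is skew-primitive for the coproduct and acts as zero on V, so all
  terms that touch the first letter cancel and the claim passes to the tail.\<close>

lemma opE_serre:
  assumes "j = Suc i \<or> i = Suc j"
  shows "opE i (opE i (opE j f)) w - (v + inverse v) * opE i (opE j (opE i f)) w
     + opE j (opE i (opE i f)) w = 0"
proof (induction w arbitrary: f)
  case (Cons a w)
  let ?g = "\<lambda>u. f (a # u)"
  have "opE i (opE i (opE j f)) (a # w) - (v + inverse v) * opE i (opE j (opE i f)) (a # w)
        + opE j (opE i (opE i f)) (a # w) = (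
      opE i (opE i (opE j ?g)) w - (v + inverse v) * opE i (opE j (opE i ?g)) w
        + opE j (opE i (opE i ?g)) w)"
    using assms
    by (cases "a = i"; cases "a = j")
      (auto simp: opE_linear opE_if opE_root_wt root_wt_def algebra_simps v_cancel)
  then show ?case
    using Cons.IH[of ?g] by simp
qed simp

lemma opE_commute:
  assumes "j \<noteq> Suc i" "i \<noteq> Suc j"
  shows "opE i (opE j f) w = opE j (opE i f) w"
proof (induction w arbitrary: f)
  case (Cons a w)
  show ?case
    using assms by (auto simp: opE_linear opE_if opE_root_wt mult.assoc Cons.IH root_wt_def)
qed simp

text \<open>As for E, except that the tail term carries the eigenvalue of the group-like factor on
  the first letter.\<close>

lemma opF_serre:
  assumes "j = Suc i \<or> i = Suc j"
  shows "opF i (opF i (opF j f)) w - (v + inverse v) * opF i (opF j (opF i f)) w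
     + opF j (opF i (opF i f)) w = 0"
proof (induction w arbitrary: f)
  case (Cons a w)
  let ?g = "\<lambda>u. f (a # u)"
  have "opF i (opF i (opF j f)) (a # w) - (v + inverse v) * opF i (opF j (opF i f)) (a # w)
        + opF j (opF i (opF i f)) (a # w) = inverse (root_wt i a) * inverse (root_wt i a) * inverse (root_wt j a) * (
      opF i (opF i (opF j ?g)) w - (v + inverse v) * opF i (opF j (opF i ?g)) w
        + opF j (opF i (opF i ?g)) w)"
    using assms
    by (cases "a = Suc i"; cases "a = Suc j")
      (auto simp: opF_linear opF_if root_wt_def algebra_simps v_cancel)
  then show ?case
    using Cons.IH[of ?g] by simp
qed simp

lemma opF_commute:
  assumes "j \<noteq> Suc i" "i \<noteq> Suc j"
  shows "opF i (opF j f) w = opF j (opF i f) w"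
proof (induction w arbitrary: f)
  case (Cons a w)
  show ?case
    using assms by (auto simp: opF_linear opF_if Cons.IH root_wt_def)
qed simp

lemma opD_opE:
  assumes "mu i \<noteq> 0"
  shows "opE i (opD mu f) w = mu (Suc i) / mu i * opD mu (opE i f) w"
  using opE_wt[of mu, OF assms, where f = f] by (simp add: opD_def[abs_def])

lemma opD_opF:
  assumes "mu (Suc i) \<noteq> 0"
  shows "opF i (opD mu f) w = mu i / mu (Suc i) * opD mu (opF i f) w"
  using opF_wt[of mu, OF assms, where f = f] by (simp add: opD_def[abs_def])

lemma opD_opD: "opD mu (opD nu f) w = opD (\<lambda>a. mu a * nu a) f w"
  by (simp add: opD_def wt_mult[symmetric])


section \<open>Presented algebras\<close>

declare zero_list_def [simp] plus_list_def [simp]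

section \<open>Noncommutative polynomials as sums of monomials, and the free algebra\<close>

lemma keys_sum_single: "finite S \<Longrightarrow> Poly_Mapping.keys (\<Sum>w\<in>S. Poly_Mapping.single w (c w)) \<subseteq> S"
  by (induction S rule: finite_induct) (auto dest!: subsetD[OF keys_add] split: if_splits)

lemma poly_mapping_as_sum:
  "finite S \<Longrightarrow> Poly_Mapping.keys p \<subseteq> S \<Longrightarrow>
     p = (\<Sum>w\<in>S. Poly_Mapping.single w (Poly_Mapping.lookup p w))"
  by (rule poly_mapping_eqI)
    (auto simp: lookup_sum lookup_single when_def in_keys_iff subset_iff)

lemma poly_mapping_keys_induct [consumes 1, case_names zero add]:
  fixes p :: "'a \<Rightarrow>\<^sub>0 'b::comm_monoid_add"
  assumes keys: "Poly_Mapping.keys p \<subseteq> S" and zero: "P 0"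
    and add: "\<And>w c q. w \<in> S \<Longrightarrow> Poly_Mapping.keys q \<subseteq> S \<Longrightarrow> P q \<Longrightarrow> P (Poly_Mapping.single w c + q)"
  shows "P p"
proof -
  have "P (\<Sum>w\<in>T. Poly_Mapping.single w (Poly_Mapping.lookup p w))" if "finite T" "T \<subseteq> S" for T
    using that
  proof (induction T rule: finite_induct)
    case (insert x T)
    then show ?case
      using keys_sum_single[of T "Poly_Mapping.lookup p"] add[of x] by (simp add: subset_trans)
  qed (simp add: zero)
  from this[of "Poly_Mapping.keys p"] show ?thesis
    using keys poly_mapping_as_sum[of "Poly_Mapping.keys p" p] by simp
qed

text \<open>Scalars become constant polynomials, supported at the empty word; closure of ideals
  under scalars is then an instance of closure under products.\<close>

lemma fscale_eq_mult: "fscale c p = Poly_Mapping.single [] c * p"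
  using mult_map_scale_conv_mult[of c p] by (simp add: zero_list_def)

lemma free_alg_simps [simp]:
  "p \<in> carrier (free_alg X) \<longleftrightarrow> Poly_Mapping.keys p \<subseteq> lists X"
  "monoid.mult (free_alg X) = (*)" "one (free_alg X) = 1" "zero (free_alg X) = 0"
  "add (free_alg X) = (+)" "smult (free_alg X) = fscale"
  by (simp_all add: free_alg_def)

lemma free_alg_closed:
  fixes p q :: "'x list \<Rightarrow>\<^sub>0 'k::comm_ring_1"
  shows "Poly_Mapping.keys p \<subseteq> lists X \<Longrightarrow> Poly_Mapping.keys q \<subseteq> lists X \<Longrightarrow>
      Poly_Mapping.keys (p + q) \<subseteq> lists X"
    "Poly_Mapping.keys p \<subseteq> lists X \<Longrightarrow> Poly_Mapping.keys q \<subseteq> lists X \<Longrightarrow>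
      Poly_Mapping.keys (p - q) \<subseteq> lists X"
    "Poly_Mapping.keys p \<subseteq> lists X \<Longrightarrow> Poly_Mapping.keys q \<subseteq> lists X \<Longrightarrow>
      Poly_Mapping.keys (p * q) \<subseteq> lists X"
    "Poly_Mapping.keys p \<subseteq> lists X \<Longrightarrow> Poly_Mapping.keys (fscale c p) \<subseteq> lists X"
    "w \<in> lists X \<Longrightarrow> Poly_Mapping.keys (Poly_Mapping.single w c :: 'x list \<Rightarrow>\<^sub>0 'k) \<subseteq> lists X"
    "Poly_Mapping.keys (1 :: 'x list \<Rightarrow>\<^sub>0 'k) \<subseteq> lists X"
proof -
  show mult: "Poly_Mapping.keys (p * q) \<subseteq> lists X"
    if "Poly_Mapping.keys p \<subseteq> lists X" "Poly_Mapping.keys q \<subseteq> lists X"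
    for p q :: "'x list \<Rightarrow>\<^sub>0 'k"
    using keys_mult[of p q] that by (fastforce simp: plus_list_def)
  show single: "Poly_Mapping.keys (Poly_Mapping.single w c :: 'x list \<Rightarrow>\<^sub>0 'k) \<subseteq> lists X"
    if "w \<in> lists X" for w c
    using that by simp
  show "Poly_Mapping.keys (fscale c p) \<subseteq> lists X" if "Poly_Mapping.keys p \<subseteq> lists X"
    unfolding fscale_eq_mult by (rule mult[OF single that]) simp
qed (use keys_add[of p q] keys_diff[of p q] in \<open>auto simp: zero_list_def\<close>)

lemma keys_uminus [simp]: "Poly_Mapping.keys (- p) = Poly_Mapping.keys p"
  by (auto simp: in_keys_iff)

lemma free_alg_ring: "ring (free_alg X :: ('k::comm_ring_1, 'x list \<Rightarrow>\<^sub>0 'k) module)"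
proof (rule ringI)
  show "abelian_group (free_alg X :: ('k, 'x list \<Rightarrow>\<^sub>0 'k) module)"
  proof (rule abelian_groupI)
    show "\<exists>q \<in> carrier (free_alg X). q \<oplus>\<^bsub>free_alg X\<^esub> p = \<zero>\<^bsub>free_alg X\<^esub>"
      if "p \<in> carrier (free_alg X)" for p :: "'x list \<Rightarrow>\<^sub>0 'k"
      using that by (intro bexI[of _ "- p"]) auto
  qed (auto simp: free_alg_closed add_ac)
  show "monoid (free_alg X :: ('k, 'x list \<Rightarrow>\<^sub>0 'k) module)"
    by (rule monoidI) (auto simp: free_alg_closed mult.assoc simp del: keys_one)
qed (auto simp: ring_distribs)

lemma free_alg_idealI:
  fixes J :: "('x list \<Rightarrow>\<^sub>0 'k::comm_ring_1) set"
  assumes "J \<subseteq> carrier (free_alg X)" "0 \<in> J"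
    and "\<And>p q. p \<in> J \<Longrightarrow> q \<in> J \<Longrightarrow> p + q \<in> J"
    and "\<And>p q. p \<in> J \<Longrightarrow> q \<in> carrier (free_alg X) \<Longrightarrow> q * p \<in> J"
    and "\<And>p q. p \<in> J \<Longrightarrow> q \<in> carrier (free_alg X) \<Longrightarrow> p * q \<in> J"
  shows "ideal J (free_alg X)"
proof (rule idealI[OF free_alg_ring])
  interpret ring "free_alg X :: ('k, 'x list \<Rightarrow>\<^sub>0 'k) module" by (rule free_alg_ring)
  have neg: "- p \<in> J" if "p \<in> J" for p
    using assms(4)[OF that, of "- 1"] by simp
  have "\<ominus>\<^bsub>free_alg X\<^esub> p = - p" if "p \<in> J" for p
    by (rule minus_equality) (use that neg subsetD[OF assms(1)] in auto)
  then show "subgroup J (add_monoid (free_alg X :: ('k, 'x list \<Rightarrow>\<^sub>0 'k) module))"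
    using assms neg by (auto simp: subgroup_def a_inv_def)
qed (use assms in auto)

section \<open>Quotients of the free algebra\<close>

locale free_ideal =
  fixes X :: "'x set" and I :: "('x list \<Rightarrow>\<^sub>0 'k::comm_ring_1) set"
  assumes ideal_I: "ideal I (free_alg X)"
begin

sublocale ideal I "free_alg X"
  by (rule ideal_I)

abbreviation cls :: "('x list \<Rightarrow>\<^sub>0 'k) \<Rightarrow> ('x list \<Rightarrow>\<^sub>0 'k) set" where
  "cls p \<equiv> I +>\<^bsub>free_alg X\<^esub> p"

lemma ideal_closed:
  "0 \<in> I"
  "p \<in> I \<Longrightarrow> q \<in> I \<Longrightarrow> p + q \<in> I"
  "p \<in> I \<Longrightarrow> - p \<in> I"
  "p \<in> I \<Longrightarrow> q \<in> I \<Longrightarrow> p - q \<in> I"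
  "p \<in> I \<Longrightarrow> q \<in> carrier (free_alg X) \<Longrightarrow> q * p \<in> I"
  "p \<in> I \<Longrightarrow> q \<in> carrier (free_alg X) \<Longrightarrow> p * q \<in> I"
  "p \<in> I \<Longrightarrow> fscale c p \<in> I"
proof -
  show left: "q * p \<in> I" if "p \<in> I" "q \<in> carrier (free_alg X)" for p q
    using I_l_closed[OF that] by simp
  show "p * q \<in> I" if "p \<in> I" "q \<in> carrier (free_alg X)"
    using I_r_closed[OF that] by simp
  show add: "p + q \<in> I" if "p \<in> I" "q \<in> I" for p q
    using additive_subgroup.a_closed[OF is_additive_subgroup that] by simp
  show neg: "- p \<in> I" if "p \<in> I" for p
    using left[OF that, of "- 1"] by simp
  show "p - q \<in> I" if "p \<in> I" "q \<in> I"
    using add[OF that(1) neg[OF that(2)]] by simp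
  show "fscale c p \<in> I" if "p \<in> I"
    unfolding fscale_eq_mult by (rule left[OF that]) simp
  show "0 \<in> I"
    using additive_subgroup.zero_closed[OF is_additive_subgroup] by simp
qed

lemma mem_cls: "q \<in> cls p \<longleftrightarrow> q - p \<in> I"
  by (auto simp: a_r_coset_def' intro: bexI[of _ "q - p"])

lemma cls_eq_iff: "cls p = cls q \<longleftrightarrow> p - q \<in> I"
proof
  assume "cls p = cls q"
  then show "p - q \<in> I"
    using mem_cls[of p p] ideal_closed(1) by (simp add: mem_cls)
next
  assume pq: "p - q \<in> I"
  have "r - p \<in> I \<longleftrightarrow> r - q \<in> I" for r
    using ideal_closed(2)[of "r - p" "p - q"] ideal_closed(4)[of "r - q" "p - q"] pq by auto
  then show "cls p = cls q"
    by (auto simp: mem_cls)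
qed

lemma quot_alg_carrier: "carrier (quot_alg (free_alg X) I) = cls ` carrier (free_alg X)"
  by (auto simp: quot_alg_def FactRing_def A_RCOSETS_def')

lemma quot_alg_ops:
  assumes "p \<in> carrier (free_alg X)"
  shows "q \<in> carrier (free_alg X) \<Longrightarrow>
      cls p \<oplus>\<^bsub>quot_alg (free_alg X) I\<^esub> cls q = cls (p + q)"
    and "q \<in> carrier (free_alg X) \<Longrightarrow>
      cls p \<otimes>\<^bsub>quot_alg (free_alg X) I\<^esub> cls q = cls (p * q)"
    and "c \<odot>\<^bsub>quot_alg (free_alg X) I\<^esub> cls p = cls (fscale c p)"
proof -
  show "cls p \<oplus>\<^bsub>quot_alg (free_alg X) I\<^esub> cls q = cls (p + q)" if "q \<in> carrier (free_alg X)"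
    using a_rcos_sum[OF assms that] by (simp add: quot_alg_def FactRing_def)
  show "cls p \<otimes>\<^bsub>quot_alg (free_alg X) I\<^esub> cls q = cls (p * q)" if "q \<in> carrier (free_alg X)"
    using rcoset_mult_add[OF assms that] by (simp add: quot_alg_def FactRing_def)
  \<comment> \<open>The scalar multiple of a coset is defined as the union of the classes of all
    scaled members; these classes coincide because the ideal absorbs scalars.\<close>
  have const: "cls (fscale c q) = cls (fscale c p)" if "q \<in> cls p" for q
    using ideal_closed(7)[of "q - p" c] that
    by (simp add: cls_eq_iff mem_cls fscale_eq_mult right_diff_distrib)
  have "p \<in> cls p"
    by (simp add: mem_cls ideal_closed)
  then have "(\<Union>q\<in>cls p. cls (fscale c q)) = cls (fscale c p)"
    using const by blast
  then show "c \<odot>\<^bsub>quot_alg (free_alg X) I\<^esub> cls p = cls (fscale c p)"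
    by (simp add: quot_alg_def)
qed

lemma quot_alg_one: "\<one>\<^bsub>quot_alg (free_alg X) I\<^esub> = cls 1"
  by (simp add: quot_alg_def FactRing_def)

lemma quot_alg_zero: "\<zero>\<^bsub>quot_alg (free_alg X) I\<^esub> = cls 0"
  using a_rcos_zero[OF ideal_I] ideal_closed(1) by (auto simp: quot_alg_def FactRing_def mem_cls)

text \<open>The quotient is a bare record, so the additive inverse is computed from its definition
  as a unique element of the carrier; uniqueness is read off from representatives.\<close>

lemma quot_alg_minus:
  assumes "p \<in> carrier (free_alg X)" "q \<in> carrier (free_alg X)"
  shows "cls p \<ominus>\<^bsub>quot_alg (free_alg X) I\<^esub> cls q = cls (p - q)"
proof -
  have "\<ominus>\<^bsub>quot_alg (free_alg X) I\<^esub> cls q = cls (- q)"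
    unfolding a_inv_def m_inv_def
  proof (rule the_equality, goal_cases)
    case 1
    have "- q \<in> carrier (free_alg X)"
      using assms by simp
    then show ?case
      using assms by (auto simp: quot_alg_carrier quot_alg_ops quot_alg_zero simp del: free_alg_simps(1))
  next
    case (2 y)
    then obtain r where r: "y = cls r" "r \<in> carrier (free_alg X)"
      by (auto simp: quot_alg_carrier)
    with 2 have "cls (q + r) = cls 0"
      using assms by (simp add: quot_alg_ops(1) quot_alg_zero del: free_alg_simps(1))
    then show ?case
      using r by (simp add: cls_eq_iff add.commute)
  qed
  then show ?thesis
    using assms quot_alg_ops(1)[of p "- q"] by (simp add: a_minus_def)
qed

text \<open>\<open>U_rep\<close> and the isomorphisms below send a coset to the single element of
  its image, which requires \<open>h\<close> to be constant on the coset.\<close>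

lemma the_elem_image_cls:
  assumes "\<And>q. q \<in> carrier (free_alg X) \<Longrightarrow> q - p \<in> I \<Longrightarrow> h q = h p"
    and "p \<in> carrier (free_alg X)"
  shows "the_elem (h ` cls p) = h p"
proof -
  have "q \<in> carrier (free_alg X)" if "q \<in> cls p" for q
    using that a_r_coset_subset_G[OF _ assms(2)] a_subset by blast
  then have "h q = h p" if "q \<in> cls p" for q
    using assms(1)[of q] that by (simp add: mem_cls)
  moreover have "p \<in> cls p"
    by (simp add: mem_cls ideal_closed)
  ultimately have "h ` cls p = {h p}"
    by blast
  then show ?thesis
    by simp
qed

text \<open>The first isomorphism theorem. One direction of \<open>ker\<close> makes
  \<open>h\<close> descend to cosets, the other makes the induced map injective.\<close>

theorem quot_alg_iso:
  assumes hom: "h \<in> alg_hom (free_alg X) B"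
    and surj: "h ` carrier (free_alg X) = carrier B"
    and ker: "\<And>p q. p \<in> carrier (free_alg X) \<Longrightarrow> q \<in> carrier (free_alg X) \<Longrightarrow>
      h p = h q \<longleftrightarrow> p - q \<in> I"
  shows "(\<lambda>C. the_elem (h ` C)) \<in> alg_iso (quot_alg (free_alg X) I) B"
    and "p \<in> carrier (free_alg X) \<Longrightarrow> the_elem (h ` cls p) = h p"
proof -
  let ?Q = "quot_alg (free_alg X) I"
  let ?h = "\<lambda>C. the_elem (h ` C)"
  show val: "?h (cls p) = h p" if "p \<in> carrier (free_alg X)" for p
    by (rule the_elem_image_cls[OF _ that]) (simp add: ker[OF _ that] del: free_alg_simps(1))
  have inj: "inj_on ?h (carrier ?Q)"
  proof (rule inj_onI)
    fix C D assume "C \<in> carrier ?Q" "D \<in> carrier ?Q" "?h C = ?h D"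
    then show "C = D"
      unfolding quot_alg_carrier by (elim imageE) (simp add: val ker cls_eq_iff del: free_alg_simps(1))
  qed
  have img: "?h ` carrier ?Q = carrier B"
    unfolding quot_alg_carrier image_image surj[symmetric] by (rule image_cong) (auto simp: val)
  have closed: "p + q \<in> carrier (free_alg X)" "p * q \<in> carrier (free_alg X)"
      "fscale c p \<in> carrier (free_alg X)"
    if "p \<in> carrier (free_alg X)" "q \<in> carrier (free_alg X)" for p q :: "'x list \<Rightarrow>\<^sub>0 'k" and c
    using that by (simp_all add: free_alg_closed)
  have one_closed: "(1 :: 'x list \<Rightarrow>\<^sub>0 'k) \<in> carrier (free_alg X)"
    by simp
  have "?h \<in> alg_hom ?Q B"
    using hom img unfolding alg_hom_def Ring.ring_hom_def
    by (auto simp: quot_alg_carrier quot_alg_ops quot_alg_one val closed one_closed simp del: free_alg_simps(1))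
  then show "?h \<in> alg_iso ?Q B"
    using inj img by (auto simp: alg_iso_def bij_betw_def)
qed

end


section \<open>Evaluation of noncommutative polynomials at operators\<close>

definition linop :: "oper \<Rightarrow> bool" where
  "linop X \<longleftrightarrow> (\<forall>f g. X (\<lambda>w. f w + g w) = (\<lambda>w. X f w + X g w)) \<and>
     (\<forall>c f. X (\<lambda>w. c * f w) = (\<lambda>w. c * X f w))"

lemma linop_add: "linop X \<Longrightarrow> X (\<lambda>w. f w + g w) = (\<lambda>w. X f w + X g w)"
  and linop_cmult: "linop X \<Longrightarrow> X (\<lambda>w. c * f w) = (\<lambda>w. c * X f w)"
  by (simp_all add: linop_def)

lemma linop_zero: "linop X \<Longrightarrow> X (\<lambda>w. 0) = (\<lambda>w. 0)"
  using linop_cmult[of X 0 "\<lambda>w. 0"] by simp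

lemma linop_diff: "linop X \<Longrightarrow> X (\<lambda>w. f w - g w) = (\<lambda>w. X f w - X g w)"
  using linop_add[of X f "\<lambda>w. - 1 * g w"] linop_cmult[of X "- 1" g] by simp

lemma linop_sum:
  assumes "linop X"
  shows "X (\<lambda>w. \<Sum>s\<in>S. c s * f s w) = (\<lambda>w. \<Sum>s\<in>S. c s * X (f s) w)"
  by (induction S rule: infinite_finite_induct)
    (simp_all add: linop_zero[OF assms] linop_add[OF assms] linop_cmult[OF assms])

text \<open>The empty word acts as \<open>e\<close>, which is the identity for \<open>U\<close> and the projection
  to the \<open>\<omega>\<close> weight space for the algebra \<open>1\<^sub>\<omega> S(n,n) 1\<^sub>\<omega>\<close>.\<close>

definition op_word :: "oper \<Rightarrow> ('x \<Rightarrow> oper) \<Rightarrow> 'x list \<Rightarrow> oper" where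
  "op_word e X xs f = foldr X xs (e f)"

definition poly_op :: "oper \<Rightarrow> ('x \<Rightarrow> oper) \<Rightarrow> ('x list \<Rightarrow>\<^sub>0 ratv) \<Rightarrow> oper" where
  "poly_op e X p f w = (\<Sum>x\<in>Poly_Mapping.keys p. Poly_Mapping.lookup p x * op_word e X x f w)"

lemma op_word_simps [simp]:
  "op_word e X [] f = e f"
  "op_word e X (x # xs) f = X x (op_word e X xs f)"
  by (simp_all add: op_word_def)

lemma poly_op_superset:
  "finite S \<Longrightarrow> Poly_Mapping.keys p \<subseteq> S \<Longrightarrow>
     poly_op e X p f w = (\<Sum>x\<in>S. Poly_Mapping.lookup p x * op_word e X x f w)"
  unfolding poly_op_def by (rule sum.mono_neutral_left) (auto simp: in_keys_iff)

lemma lookup_fscale [simp]: "Poly_Mapping.lookup (fscale c p) x = c * Poly_Mapping.lookup p x"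
  by (simp add: map.rep_eq when_def)

lemma keys_fscale: "Poly_Mapping.keys (fscale c p) \<subseteq> Poly_Mapping.keys p"
  by (auto simp: in_keys_iff)

lemma poly_op_zero [simp]: "poly_op e X 0 f w = 0"
  by (simp add: poly_op_def)

lemma poly_op_single [simp]: "poly_op e X (Poly_Mapping.single x c) f w = c * op_word e X x f w"
  by (subst poly_op_superset[of "{x}"]) auto

lemma poly_op_one [simp]: "poly_op e X (1 :: 'a list \<Rightarrow>\<^sub>0 ratv) f w = e f w"
proof -
  have one: "(1 :: 'a list \<Rightarrow>\<^sub>0 ratv) = Poly_Mapping.single [] 1"
    using single_one[where ?'a = "'a list" and ?'b = ratv] by simp
  show ?thesis
    unfolding one poly_op_single by simp
qed

lemma poly_op_linear [simp]:
  "poly_op e X (p + q) f w = poly_op e X p f w + poly_op e X q f w"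
  "poly_op e X (p - q) f w = poly_op e X p f w - poly_op e X q f w"
  "poly_op e X (fscale c p) f w = c * poly_op e X p f w"
proof -
  let ?S = "Poly_Mapping.keys p \<union> Poly_Mapping.keys q"
  show "poly_op e X (p + q) f w = poly_op e X p f w + poly_op e X q f w"
    using keys_add[of p q]
    by (simp add: poly_op_superset[of ?S] lookup_add ring_distribs sum.distrib)
  show "poly_op e X (p - q) f w = poly_op e X p f w - poly_op e X q f w"
    using keys_diff[of p q]
    by (simp add: poly_op_superset[of ?S] lookup_minus ring_distribs sum_subtractf)
  show "poly_op e X (fscale c p) f w = c * poly_op e X p f w"
    using poly_op_superset[of "Poly_Mapping.keys p" "fscale c p" e X f w] keys_fscale[of c p]
    by (simp add: poly_op_def[of e X p] sum_distrib_left mult.assoc)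
qed

text \<open>The operator \<open>e\<close> is an idempotent that every \<open>X x\<close> absorbs on
  both sides, so the \<open>X x\<close> live in the corner cut out by \<open>e\<close>.\<close>

locale op_assignment =
  fixes e :: oper and X :: "'x \<Rightarrow> oper"
  assumes linop_e: "linop e" and linop_X: "linop (X x)"
    and e_e [simp]: "e (e f) = e f"
    and e_X [simp]: "e (X x f) = X x f"
    and X_e [simp]: "X x (e f) = X x f"
begin

lemma linop_op_word: "linop (op_word e X xs)"
proof (induction xs)
  case Nil
  then show ?case
    using linop_e by (simp add: linop_def)
next
  case (Cons x xs)
  then show ?case
    using linop_X[of x] by (simp add: linop_def)
qed

lemma linop_poly_op: "linop (poly_op e X p)"
  by (simp add: linop_def poly_op_def fun_eq_iff linop_add[OF linop_op_word]
    linop_cmult[OF linop_op_word] ring_distribs sum.distrib sum_distrib_left mult.left_commute)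

lemma e_op_word [simp]: "e (op_word e X xs f) = op_word e X xs f"
  by (cases xs) simp_all

text \<open>The right-hand side contains \<open>e\<close> twice and the left-hand side once; the
  additional factor is absorbed.\<close>

lemma op_word_append: "op_word e X (xs @ ys) f = op_word e X xs (op_word e X ys f)"
  by (induction xs) simp_all

lemma e_poly_op [simp]: "e (poly_op e X p f) = poly_op e X p f"
  by (simp add: poly_op_def[abs_def] linop_sum[OF linop_e])

lemma poly_op_e [simp]: "poly_op e X p (e f) = poly_op e X p f"
proof -
  have "op_word e X xs (e f) = op_word e X xs f" for xs
    by (induction xs) simp_all
  then show ?thesis
    by (simp add: poly_op_def[abs_def])
qed

lemma poly_op_fvar [simp]: "poly_op e X (fvar x) f w = X x f w"
  by simp

lemma poly_op_mult [simp]: "poly_op e X (p * q) f w = poly_op e X p (poly_op e X q f) w"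
proof -
  have single: "poly_op e X (Poly_Mapping.single xs c * q) f w
      = c * op_word e X xs (poly_op e X q f) w" for xs c q f w
  proof (induction q arbitrary: w rule: poly_mapping_keys_induct[OF subset_UNIV, case_names zero add])
    case zero
    show ?case
      by (simp add: poly_op_def[abs_def] linop_zero[OF linop_op_word])
  next
    case (add ys d q)
    have "poly_op e X (Poly_Mapping.single ys d + q) f
        = (\<lambda>u. d * op_word e X ys f u + poly_op e X q f u)"
      by (rule ext) simp
    then show ?case
      by (simp add: ring_distribs mult_single add op_word_append linop_add[OF linop_op_word]
        linop_cmult[OF linop_op_word])
  qed
  show ?thesis
    by (induction p rule: poly_mapping_keys_induct[OF subset_UNIV, case_names zero add])
      (simp_all add: ring_distribs single)
qed

lemma poly_op_kernel_ideal:
  "ideal {p \<in> carrier (free_alg Y). \<forall>f w. poly_op e X p f w = 0} (free_alg Y)"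
proof (rule free_alg_idealI)
  have zero: "poly_op e X p f = (\<lambda>w. 0)" if "\<forall>f w. poly_op e X p f w = 0" for p f
    using that by auto
  show "q * p \<in> {p \<in> carrier (free_alg Y). \<forall>f w. poly_op e X p f w = 0}"
    if "p \<in> {p \<in> carrier (free_alg Y). \<forall>f w. poly_op e X p f w = 0}"
      "q \<in> carrier (free_alg Y)" for p q
    using that by (auto simp: free_alg_closed zero linop_zero[OF linop_poly_op])
qed (auto simp: free_alg_closed)

text \<open>The polynomials that act as zero form a two-sided ideal, so it suffices to test the
  relations themselves.\<close>

lemma poly_op_eq_0_on_genideal:
  assumes "\<And>r f w. r \<in> R \<Longrightarrow> r \<in> carrier (free_alg Y) \<and> poly_op e X r f w = 0"
    and "p \<in> genideal (free_alg Y) R"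
  shows "poly_op e X p f w = 0"
proof -
  have "genideal (free_alg Y) R \<subseteq> {p \<in> carrier (free_alg Y). \<forall>f w. poly_op e X p f w = 0}"
    by (rule ring.genideal_minimal[OF free_alg_ring poly_op_kernel_ideal]) (use assms(1) in blast)
  then show ?thesis
    using assms(2) by auto
qed

end


section \<open>Matrices of operators on words\<close>

definition words :: "nat \<Rightarrow> nat \<Rightarrow> nat list set" where
  "words n d = {w. length w = d \<and> set w \<subseteq> {1..n}}"

text \<open>The base \<open>n\<close> expansion of \<open>r\<close>, most significant digit first
  and with digits shifted by 1. This is the lexicographic order in which \<open>kron\<close>
  arranges a product basis.\<close>

fun word :: "nat \<Rightarrow> nat \<Rightarrow> nat \<Rightarrow> nat list" where
  "word n 0 r = []"
| "word n (Suc d) r = Suc (r div n ^ d) # word n d (r mod n ^ d)"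

definition delta :: "'a \<Rightarrow> 'a \<Rightarrow> ratv" where
  "delta u w = (if w = u then 1 else 0)"

definition word_mat :: "nat \<Rightarrow> nat \<Rightarrow> oper \<Rightarrow> ratv mat" where
  "word_mat n d X = mat (n ^ d) (n ^ d) (\<lambda>(r, c). X (delta (word n d c)) (word n d r))"

text \<open>Operators act on functions of all words over all letters. Locality says that the
  restriction to \<open>words n d\<close> is well defined, which is what turns composition into the
  matrix product.\<close>

definition local_op :: "nat \<Rightarrow> nat \<Rightarrow> oper \<Rightarrow> bool" where
  "local_op n d X \<longleftrightarrow> linop X \<and>
     (\<forall>f g. (\<forall>u\<in>words n d. f u = g u) \<longrightarrow> (\<forall>w\<in>words n d. X f w = X g w))"

lemma local_op_linop: "local_op n d X \<Longrightarrow> linop X"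
  and local_op_cong: "local_op n d X \<Longrightarrow> (\<And>u. u \<in> words n d \<Longrightarrow> f u = g u) \<Longrightarrow>
    w \<in> words n d \<Longrightarrow> X f w = X g w"
  unfolding local_op_def by blast+

lemma words_Suc: "a # w \<in> words n (Suc d) \<longleftrightarrow> a \<in> {1..n} \<and> w \<in> words n d"
  by (auto simp: words_def)

lemma finite_words [simp]: "finite (words n d)"
  using finite_lists_length_eq[of "{1..n}" d] by (simp add: words_def conj_commute)

lemma bij_betw_word: "bij_betw (word n d) {..<n ^ d} (words n d)"
proof (induction d)
  case 0
  show ?case
    by (auto simp: bij_betw_def words_def inj_on_def)
next
  case (Suc d)
  show ?case
  \<comment> \<open>For \<open>n = 0\<close> the divisor \<open>n ^ d\<close> may be 0, but then
    there are no words of positive length.\<close>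
  proof (cases "n = 0")
    case True
    then show ?thesis
      by (auto simp: bij_betw_def words_def)
  next
    case False
    show ?thesis
      unfolding bij_betw_def
    proof
      show "inj_on (word n (Suc d)) {..<n ^ Suc d}"
      proof (rule inj_onI)
        fix r s assume eq: "word n (Suc d) r = word n (Suc d) s"
        have "r mod n ^ d = s mod n ^ d"
          using Suc.IH eq False by (auto simp: bij_betw_def inj_on_def)
        moreover have "r div n ^ d = s div n ^ d"
          using eq by simp
        ultimately show "r = s"
          by (metis div_mult_mod_eq)
      qed
      show "word n (Suc d) ` {..<n ^ Suc d} = words n (Suc d)"
      proof (intro subset_antisym subsetI)
        fix w assume "w \<in> word n (Suc d) ` {..<n ^ Suc d}"
        then obtain r where r: "r < n * n ^ d" "w = word n (Suc d) r"
          by auto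
        have "word n d (r mod n ^ d) \<in> words n d"
          using bij_betwE[OF Suc.IH] False by auto
        moreover have "r div n ^ d < n"
          using r(1) by (simp add: less_mult_imp_div_less)
        ultimately show "w \<in> words n (Suc d)"
          using r(2) by (simp add: words_Suc)
      next
        fix w assume "w \<in> words n (Suc d)"
        then obtain a u where w: "w = Suc a # u" "a < n" "u \<in> words n d"
          by (cases w) (auto simp: words_def Suc_le_eq dest!: gr0_implies_Suc)
        then obtain s where s: "s < n ^ d" "u = word n d s"
          using Suc.IH by (auto simp: bij_betw_def)
        have "a * n ^ d + s < Suc a * n ^ d"
          using s(1) by simp
        also have "\<dots> \<le> n * n ^ d"
          using w(2) by (intro mult_le_mono1) simp
        finally have "a * n ^ d + s < n * n ^ d" .
        moreover have "w = word n (Suc d) (a * n ^ d + s)"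
          using w s by simp
        ultimately show "w \<in> word n (Suc d) ` {..<n ^ Suc d}"
          by auto
      qed
    qed
  qed
qed

lemma word_in_words: "r < n ^ d \<Longrightarrow> word n d r \<in> words n d"
  using bij_betwE[OF bij_betw_word] by blast

lemma word_mat_dims [simp]:
  "word_mat n d X \<in> carrier_mat (n ^ d) (n ^ d)"
  "dim_row (word_mat n d X) = n ^ d" "dim_col (word_mat n d X) = n ^ d"
  by (simp_all add: word_mat_def)

lemma word_mat_index [simp]:
  "r < n ^ d \<Longrightarrow> c < n ^ d \<Longrightarrow>
     word_mat n d X $$ (r, c) = X (delta (word n d c)) (word n d r)"
  by (simp add: word_mat_def)

lemma word_mat_eq_iff:
  "word_mat n d X = word_mat n d Y \<longleftrightarrow>
     (\<forall>u\<in>words n d. \<forall>w\<in>words n d. X (delta u) w = Y (delta u) w)"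
proof
  assume eq: "word_mat n d X = word_mat n d Y"
  show "\<forall>u\<in>words n d. \<forall>w\<in>words n d. X (delta u) w = Y (delta u) w"
  proof (intro ballI)
    fix u w assume "u \<in> words n d" "w \<in> words n d"
    then obtain r c where "r < n ^ d" "c < n ^ d" "w = word n d r" "u = word n d c"
      using bij_betw_imp_surj_on[OF bij_betw_word] by (metis imageE lessThan_iff)
    then show "X (delta u) w = Y (delta u) w"
      using arg_cong[OF eq, of "\<lambda>M. M $$ (r, c)"] by simp
  qed
qed (auto intro!: eq_matI simp: word_in_words)

lemma word_mat_linear:
  "word_mat n d (\<lambda>f w. X f w + Y f w) = word_mat n d X + word_mat n d Y"
  "word_mat n d (\<lambda>f w. c * X f w) = c \<cdot>\<^sub>m word_mat n d X"
  "word_mat n d (\<lambda>f w. 0) = 0\<^sub>m (n ^ d) (n ^ d)"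
  by (auto intro!: eq_matI)

text \<open>On \<open>words n d\<close> the function \<open>f\<close> agrees with a combination of
  the \<open>delta u\<close>, and locality permits the replacement.\<close>

lemma local_op_expand:
  assumes "local_op n d X" "w \<in> words n d"
  shows "X f w = (\<Sum>u\<in>words n d. f u * X (delta u) w)"
proof -
  have "X f w = X (\<lambda>w. \<Sum>u\<in>words n d. f u * delta u w) w"
    by (rule local_op_cong[OF assms(1) _ assms(2)])
      (simp add: delta_def if_distrib sum.delta' cong: if_cong)
  then show ?thesis
    by (simp add: linop_sum[OF local_op_linop[OF assms(1)]])
qed

lemma word_mat_comp:
  assumes "local_op n d X"
  shows "word_mat n d (\<lambda>f. X (Y f)) = word_mat n d X * word_mat n d Y"
proof (rule eq_matI)
  fix r c assume "r < dim_row (word_mat n d X * word_mat n d Y)"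
    "c < dim_col (word_mat n d X * word_mat n d Y)"
  then have rc: "r < n ^ d" "c < n ^ d"
    by simp_all
  let ?r = "word n d r" and ?c = "word n d c"
  have "X (Y (delta ?c)) ?r = (\<Sum>u\<in>words n d. Y (delta ?c) u * X (delta u) ?r)"
    by (rule local_op_expand[OF assms word_in_words[OF rc(1)]])
  also have "\<dots> = (\<Sum>k<n ^ d. Y (delta ?c) (word n d k) * X (delta (word n d k)) ?r)"
    by (rule sum.reindex_bij_betw[OF bij_betw_word, symmetric])
  finally show "word_mat n d (\<lambda>f. X (Y f)) $$ (r, c) = (word_mat n d X * word_mat n d Y) $$ (r, c)"
    using rc by (simp add: scalar_prod_def atLeast0LessThan mult.commute)
qed simp_all

lemma local_op_comp:
  assumes X: "local_op n d X" and Y: "local_op n d Y"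
  shows "local_op n d (\<lambda>f. X (Y f))"
proof -
  note lin = local_op_linop[OF X] local_op_linop[OF Y]
  have "linop (\<lambda>f. X (Y f))"
    unfolding linop_def by (simp add: linop_add[OF lin(1)] linop_add[OF lin(2)]
      linop_cmult[OF lin(1)] linop_cmult[OF lin(2)])
  then show ?thesis
    unfolding local_op_def using local_op_cong[OF X] local_op_cong[OF Y] by blast
qed

lemma word_mat_id: "word_mat n d (\<lambda>f. f) = 1\<^sub>m (n ^ d)"
  using bij_betw_imp_inj_on[OF bij_betw_word, of n d]
  by (auto intro!: eq_matI simp: delta_def inj_on_def)

lemma local_op_word:
  assumes "local_op n d e" "\<And>x. x \<in> Y \<Longrightarrow> local_op n d (X x)" "xs \<in> lists Y"
  shows "local_op n d (op_word e X xs)"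
  using assms(3)
proof (induction xs)
  case Nil
  then show ?case
    using assms(1) by (simp add: op_word_def[abs_def])
next
  case (Cons x xs)
  then show ?case
    using local_op_comp[OF assms(2)[of x]] by (simp add: op_word_def[abs_def])
qed

lemma local_poly_op:
  assumes "local_op n d e" "\<And>x. x \<in> Y \<Longrightarrow> local_op n d (X x)" "Poly_Mapping.keys p \<subseteq> lists Y"
  shows "local_op n d (poly_op e X p)"
proof -
  have loc: "local_op n d (op_word e X xs)" if "xs \<in> Poly_Mapping.keys p" for xs
    by (rule local_op_word[OF assms(1,2)]) (use that assms(3) in auto)
  note lin = local_op_linop[OF loc]
  have "poly_op e X p (\<lambda>w. f w + g w) u = poly_op e X p f u + poly_op e X p g u" for f g u
    unfolding poly_op_def sum.distrib[symmetric]
    by (intro sum.cong refl) (simp add: linop_add[OF lin] distrib_left)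
  moreover have "poly_op e X p (\<lambda>w. c * f w) u = c * poly_op e X p f u" for c f u
    unfolding poly_op_def sum_distrib_left
    by (intro sum.cong refl) (simp add: linop_cmult[OF lin] mult.left_commute)
  ultimately have "linop (poly_op e X p)"
    by (simp add: linop_def fun_eq_iff)
  moreover have "poly_op e X p f w = poly_op e X p g w"
    if "\<forall>u\<in>words n d. f u = g u" "w \<in> words n d" for f g w
    unfolding poly_op_def
    by (intro sum.cong refl arg_cong2[where f = "(*)"] local_op_cong[OF loc])
      (use that in auto)
  ultimately show ?thesis
    unfolding local_op_def by blast
qed

section \<open>The tensor representation\<close>

lemma op_gen_linop: "linop (op_gen g)"
  by (cases g) (auto simp: linop_def opE_linear opF_linear opD_def fun_eq_iff algebra_simps)

text \<open>\<open>opE i\<close> reads words in which \<open>i\<close> has become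
  \<open>Suc i\<close>; these stay over the letters up to \<open>n\<close> because
  \<open>i < n\<close>.\<close>

lemma opE_cong:
  assumes "w \<in> words n d" "i < n" "\<And>u. u \<in> words n d \<Longrightarrow> f u = g u"
  shows "opE i f w = opE i g w"
  using assms
proof (induction w arbitrary: d f g)
  case (Cons a w)
  then obtain d' where d: "d = Suc d'"
    by (auto simp: words_def)
  have w: "w \<in> words n d'" and a: "a \<in> {1..n}"
    using Cons.prems(1) by (simp_all add: d words_Suc)
  have "opE i (\<lambda>u. f (a # u)) w = opE i (\<lambda>u. g (a # u)) w"
    by (rule Cons.IH[OF w Cons.prems(2)]) (use a Cons.prems(3) in \<open>simp add: d words_Suc\<close>)
  moreover have "f (Suc i # w) = g (Suc i # w)"
    by (rule Cons.prems(3)) (use w Cons.prems(2) in \<open>simp add: d words_Suc\<close>)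
  ultimately show ?case
    by simp
qed simp

lemma opF_cong:
  assumes "w \<in> words n d" "1 \<le> i" "i \<le> n" "\<And>u. u \<in> words n d \<Longrightarrow> f u = g u"
  shows "opF i f w = opF i g w"
  using assms
proof (induction w arbitrary: d f g)
  case (Cons a w)
  then obtain d' where d: "d = Suc d'"
    by (auto simp: words_def)
  have w: "w \<in> words n d'" and a: "a \<in> {1..n}"
    using Cons.prems(1) by (simp_all add: d words_Suc)
  have "opF i (\<lambda>u. f (a # u)) w = opF i (\<lambda>u. g (a # u)) w"
    by (rule Cons.IH[OF w Cons.prems(2,3)]) (use a Cons.prems(4) in \<open>simp add: d words_Suc\<close>)
  moreover have "f (i # w) = g (i # w)"
    by (rule Cons.prems(4)) (use w Cons.prems(2,3) in \<open>simp add: d words_Suc\<close>)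
  ultimately show ?case
    by simp
qed simp

lemma local_opD [simp]: "local_op n d (opD mu)"
  by (auto simp: local_op_def linop_def opD_def fun_eq_iff algebra_simps)

lemma local_op_id [simp]: "local_op n d (\<lambda>f. f)"
  by (simp add: local_op_def linop_def)

lemma local_op_gen:
  assumes "g \<in> ugens n"
  shows "local_op n d (op_gen g)"
proof -
  have "op_gen g f w = op_gen g h w" if "\<forall>u\<in>words n d. f u = h u" "w \<in> words n d" for f h w
    using assms that opE_cong[of w n d _ f h] opF_cong[of w n d _ f h]
    by (auto simp: ugens_def opD_def)
  then show ?thesis
    by (auto simp: local_op_def op_gen_linop)
qed

section \<open>Kronecker products and the matrices of the tensor representation\<close>

lemma mat1_index [simp]:
  "r < n \<Longrightarrow> c < n \<Longrightarrow> mat1 n f $$ (r, c) = f (Suc r) (Suc c)"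
  "dim_row (mat1 n f) = n" "dim_col (mat1 n f) = n"
  by (simp_all add: mat1_def)

lemma mat1_diag_mult:
  "mat1 n (\<lambda>a b. if a = b then x a else 0) * mat1 n (\<lambda>a b. if a = b then y a else 0) =
     mat1 n (\<lambda>a b. if a = b then x a * y a else 0)"
proof (rule eq_matI)
  fix i j assume "i < dim_row (mat1 n (\<lambda>a b. if a = b then x a * y a else 0))"
    "j < dim_col (mat1 n (\<lambda>a b. if a = b then x a * y a else 0))"
  then have ij: "i < n" "j < n"
    by simp_all
  have "(\<Sum>k = 0..<n. (if Suc i = Suc k then x (Suc i) else 0) * (if Suc k = Suc j then y (Suc k) else 0))
      = (\<Sum>k = 0..<n. if k = j then if i = j then x (Suc i) * y (Suc i) else 0 else 0)"
    by (rule sum.cong) auto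
  then show "(mat1 n (\<lambda>a b. if a = b then x a else 0) * mat1 n (\<lambda>a b. if a = b then y a else 0)) $$ (i, j)
      = mat1 n (\<lambda>a b. if a = b then x a * y a else 0) $$ (i, j)"
    using ij by (simp add: scalar_prod_def)
qed simp_all

lemma mat1_one: "1\<^sub>m n = mat1 n (\<lambda>a b. if a = b then 1 else 0)"
  by (rule eq_matI) (auto simp: mat1_def)

lemma nat_rep_root:
  "nat_rep n (Kinv i) * nat_rep n (K (i + 1)) =
     mat1 n (\<lambda>a b. if a = b then inverse (root_wt i a) else 0)"
proof -
  have K: "nat_rep n (K j) = mat1 n (\<lambda>a b. if a = b then if j = a then v else 1 else 0)" for j
    by (simp add: if_distrib cong: if_cong)
  have Kinv: "nat_rep n (Kinv j) = mat1 n (\<lambda>a b. if a = b then if j = a then inverse v else 1 else 0)" for j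
    by (simp add: power_int_minus if_distrib cong: if_cong)
  show ?thesis
    unfolding K Kinv mat1_diag_mult
    by (rule arg_cong[where f = "mat1 n"]) (auto simp: root_wt_def fun_eq_iff)
qed

text \<open>Division with remainder by \<open>n ^ d\<close> splits an index exactly as
  \<open>word\<close> splits off the first letter.\<close>

lemma kron_word_mat:
  "kron (mat1 n x) (word_mat n d X) =
     mat (n ^ Suc d) (n ^ Suc d) (\<lambda>(r, c). x (Suc (r div n ^ d)) (Suc (c div n ^ d))
       * X (delta (word n d (c mod n ^ d))) (word n d (r mod n ^ d)))"
proof (cases "n = 0")
  case True
  then show ?thesis
    by (auto simp: kron_def intro!: eq_matI)
next
  case False
  then show ?thesis
    by (auto simp: kron_def less_mult_imp_div_less intro!: eq_matI)
qed

lemma delta_Cons: "delta (a # u) (b # w) = (if b = a then delta u w else 0)"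
  by (simp add: delta_def)

lemma local_opD_comp: "word_mat n d (opD mu) * word_mat n d (opD nu) = word_mat n d (opD (\<lambda>a. mu a * nu a))"
  by (simp add: word_mat_comp[symmetric] opD_opD[abs_def])

text \<open>\<open>tens_rep\<close> and the operators obey the same coproduct recursion; the
  induction compares entries after the first letter is split off.\<close>

lemma tens_rep_word_mat: "tens_rep n d g = word_mat n d (op_gen g)"
proof (induction d arbitrary: g)
  case 0
  show ?case
    by (cases g) (auto intro!: eq_matI simp: opD_def delta_def)
next
  case (Suc d)
  have root: "word_mat n d (op_gen (K i)) * word_mat n d (op_gen (Kinv (i + 1)))
      = word_mat n d (opD (root_wt i))" for i
    unfolding op_gen.simps local_opD_comp
    by (intro arg_cong[where f = "\<lambda>X. word_mat n d (opD X)"]) (auto simp: root_wt_def)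
  have inj: "word n d r = word n d c \<longleftrightarrow> r = c" if "r < n ^ d" "c < n ^ d" for r c
    using bij_betw_imp_inj_on[OF bij_betw_word, of n d] that by (auto simp: inj_on_def)
  show ?case
  proof (cases g)
    case (E i)
    show ?thesis
      unfolding E tens_rep.simps Suc.IH root nat_rep.simps mat1_one kron_word_mat
      by (auto intro!: eq_matI simp: delta_Cons opE_if opE_linear opD_def)
  next
    case (F i)
    show ?thesis
      unfolding F tens_rep.simps Suc.IH nat_rep_root word_mat_id[symmetric]
      unfolding nat_rep.simps kron_word_mat
      by (auto intro!: eq_matI simp: delta_Cons opF_if opF_linear)
  next
    case (K i)
    show ?thesis
      unfolding K tens_rep.simps Suc.IH nat_rep.simps kron_word_mat
      by (auto intro!: eq_matI simp: delta_Cons opD_def)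
  next
    case (Kinv i)
    show ?thesis
      unfolding Kinv tens_rep.simps Suc.IH nat_rep.simps kron_word_mat
      by (auto intro!: eq_matI simp: delta_Cons opD_def power_int_minus)
  qed
qed

lemma End_tens_simps [simp]:
  "carrier (End_tens n d) = carrier_mat (n ^ d) (n ^ d)"
  "monoid.mult (End_tens n d) = (*)" "one (End_tens n d) = 1\<^sub>m (n ^ d)"
  "zero (End_tens n d) = 0\<^sub>m (n ^ d) (n ^ d)"
  "add (End_tens n d) = (+)" "smult (End_tens n d) = (\<cdot>\<^sub>m)"
  by (simp_all add: End_tens_def module_mat_def)

lemma End_tens_abelian_monoid: "abelian_monoid (End_tens n d)"
  by (rule abelian_monoidI) (auto simp: comm_add_mat assoc_add_mat)

lemma End_tens_finsum:
  assumes "finite S"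
  shows "(\<Oplus>\<^bsub>End_tens n d\<^esub>s\<in>S. c s \<cdot>\<^sub>m word_mat n d (X s)) = word_mat n d (\<lambda>f w. \<Sum>s\<in>S. c s * X s f w)"
  using assms
proof (induction S rule: finite_induct)
  case empty
  show ?case
    by (simp add: abelian_monoid.finsum_empty[OF End_tens_abelian_monoid] word_mat_linear)
next
  case (insert s S)
  then show ?case
    by (simp add: abelian_monoid.finsum_insert[OF End_tens_abelian_monoid] word_mat_linear)
qed

lemma free_eval_word_mat:
  assumes "\<And>x. x \<in> Y \<Longrightarrow> local_op n d (X x)" "Poly_Mapping.keys p \<subseteq> lists Y"
  shows "free_eval (End_tens n d) (\<lambda>x. word_mat n d (X x)) p = word_mat n d (poly_op (\<lambda>f. f) X p)"
proof -
  have "ordered_prod (End_tens n d) (map (\<lambda>x. word_mat n d (X x)) xs) = word_mat n d (op_word (\<lambda>f. f) X xs)"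
    if "xs \<in> lists Y" for xs
    using that
  proof (induction xs)
    case Nil
    show ?case
      by (simp add: ordered_prod_def op_word_def[abs_def] word_mat_id)
  next
    case (Cons x xs)
    have "word_mat n d (op_word (\<lambda>f. f) X (x # xs)) = word_mat n d (X x) * word_mat n d (op_word (\<lambda>f. f) X xs)"
      using word_mat_comp[OF assms(1), of x "op_word (\<lambda>f. f) X xs"] Cons.hyps
      by (simp add: op_word_def[abs_def] comp_def)
    then show ?case
      using Cons.IH by (simp add: ordered_prod_def del: op_word_simps)
  qed
  then have "free_eval (End_tens n d) (\<lambda>x. word_mat n d (X x)) p =
      (\<Oplus>\<^bsub>End_tens n d\<^esub>s\<in>Poly_Mapping.keys p. Poly_Mapping.lookup p s \<cdot>\<^sub>m word_mat n d (op_word (\<lambda>f. f) X s))"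
    unfolding free_eval_def using assms(2)
    by (intro abelian_monoid.finsum_cong'[OF End_tens_abelian_monoid] refl) (simp_all add: subset_iff)
  also have "\<dots> = word_mat n d (poly_op (\<lambda>f. f) X p)"
    by (simp add: End_tens_finsum poly_op_def[abs_def])
  finally show ?thesis .
qed

abbreviation U_op :: "(ugen list \<Rightarrow>\<^sub>0 ratv) \<Rightarrow> oper" where
  "U_op \<equiv> poly_op (\<lambda>f. f) op_gen"

interpretation U_ops: op_assignment "\<lambda>f. f" op_gen
  by standard (simp_all add: op_gen_linop, simp add: linop_def)

text \<open>With the identity in the place of \<open>e\<close>, these simplification rules make the simplifier loop.\<close>

declare U_ops.e_e [simp del] U_ops.e_X [simp del] U_ops.X_e [simp del]
  U_ops.e_op_word [simp del] U_ops.e_poly_op [simp del] U_ops.poly_op_e [simp del]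

lemma U_op_fvar: "U_op (fvar x) = op_gen x"
  by (intro ext U_ops.poly_op_fvar)

lemma U_op_mult: "U_op (p * q) f = U_op p (U_op q f)"
  by (intro ext U_ops.poly_op_mult)

lemma fvar_in_free_alg: "x \<in> X \<Longrightarrow> fvar x \<in> carrier (free_alg X)"
  by simp

lemma free_alg_closed':
  fixes p q :: "'x list \<Rightarrow>\<^sub>0 'k::comm_ring_1"
  shows "p \<in> carrier (free_alg X) \<Longrightarrow> q \<in> carrier (free_alg X) \<Longrightarrow> p + q \<in> carrier (free_alg X)"
    "p \<in> carrier (free_alg X) \<Longrightarrow> q \<in> carrier (free_alg X) \<Longrightarrow> p - q \<in> carrier (free_alg X)"
    "p \<in> carrier (free_alg X) \<Longrightarrow> q \<in> carrier (free_alg X) \<Longrightarrow> p * q \<in> carrier (free_alg X)"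
    "p \<in> carrier (free_alg X) \<Longrightarrow> fscale c p \<in> carrier (free_alg X)"
    "(1 :: 'x list \<Rightarrow>\<^sub>0 'k) \<in> carrier (free_alg X)" "(0 :: 'x list \<Rightarrow>\<^sub>0 'k) \<in> carrier (free_alg X)"
  by (simp_all add: free_alg_closed)

section \<open>The defining relations of U act as zero\<close>

lemma ugens_iff [simp]:
  "E i \<in> ugens n \<longleftrightarrow> i \<in> {1..<n}" "F i \<in> ugens n \<longleftrightarrow> i \<in> {1..<n}"
  "K i \<in> ugens n \<longleftrightarrow> i \<in> {1..n}" "Kinv i \<in> ugens n \<longleftrightarrow> i \<in> {1..n}"
  by (auto simp: ugens_def)

lemma serre_rels_closed:
  assumes "\<And>i. i \<in> {1..<n} \<Longrightarrow> Y i \<in> X"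
  shows "serre_rels n Y \<subseteq> carrier (free_alg X)"
  unfolding serre_rels_def
  by (auto intro!: free_alg_closed' fvar_in_free_alg assms simp del: free_alg_simps(1))

lemma urels_closed: "urels n \<subseteq> carrier (free_alg (ugens n))"
  using serre_rels_closed[of n E "ugens n"] serre_rels_closed[of n F "ugens n"]
  unfolding urels_def
  by (auto intro!: free_alg_closed' fvar_in_free_alg simp del: free_alg_simps(1))

lemma pairing_eps:
  assumes "i \<in> {1..n}"
  shows "pairing n (eps i) x = x i"
  using assms by (simp add: pairing_def eps_def if_distrib[of "\<lambda>y. y * _"] cong: if_cong)

lemma wt_eq_1: "(\<And>a. a \<in> set w \<Longrightarrow> mu a = 1) \<Longrightarrow> wt mu w = 1"
  by (induction w) simp_all

lemma opK_opE:
  "opD (\<lambda>a. if a = i then v else 1) (opE j f) w =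
     v powi simple_root j i * opE j (opD (\<lambda>a. if a = i then v else 1) f) w"
  by (auto simp: opD_opE simple_root_def eps_def power_int_minus)

lemma opK_opF:
  "opD (\<lambda>a. if a = i then v else 1) (opF j f) w =
     v powi (- simple_root j i) * opF j (opD (\<lambda>a. if a = i then v else 1) f) w"
  by (auto simp: opD_opF simple_root_def eps_def power_int_minus)

lemma opD_K_Kinv:
  "opD (\<lambda>a. if a = i then v else 1) (opD (\<lambda>a. if a = Suc i then inverse v else 1) f) w
     = wt (root_wt i) w * f w"
  "opD (\<lambda>a. if a = i then inverse v else 1) (opD (\<lambda>a. if a = Suc i then v else 1) f) w
     = wt (\<lambda>a. inverse (root_wt i a)) w * f w"
  unfolding opD_opD unfolding opD_def
  by (rule arg_cong2[where f = "(*)"] arg_cong2[where f = wt] refl | force simp: root_wt_def)+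

lemma U_op_serre_rels:
  assumes "\<And>i j f w. j = Suc i \<or> i = Suc j \<Longrightarrow>
      op_gen (Y i) (op_gen (Y i) (op_gen (Y j) f)) w
        - (v + inverse v) * op_gen (Y i) (op_gen (Y j) (op_gen (Y i) f)) w
        + op_gen (Y j) (op_gen (Y i) (op_gen (Y i) f)) w = 0"
    and "\<And>i j f w. j \<noteq> Suc i \<Longrightarrow> i \<noteq> Suc j \<Longrightarrow>
      op_gen (Y i) (op_gen (Y j) f) w = op_gen (Y j) (op_gen (Y i) f) w"
    and "r \<in> serre_rels n Y"
  shows "U_op r f w = 0"
  using assms(3) unfolding serre_rels_def
proof (elim UnE CollectE exE conjE)
  fix i j assume "\<bar>int i - int j\<bar> = 1"
    and r: "r = fvar (Y i) * fvar (Y i) * fvar (Y j)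
      - fscale (v + v powi (- 1)) (fvar (Y i) * fvar (Y j) * fvar (Y i))
      + fvar (Y j) * fvar (Y i) * fvar (Y i)"
  then have "j = Suc i \<or> i = Suc j"
    by linarith
  from assms(1)[OF this, of f w] show ?thesis
    by (simp only: r poly_op_linear U_op_mult U_op_fvar power_int_minus power_int_1_right)
next
  fix i j assume "\<bar>int i - int j\<bar> \<noteq> 1" and r: "r = fvar (Y i) * fvar (Y j) - fvar (Y j) * fvar (Y i)"
  then have "j \<noteq> Suc i" "i \<noteq> Suc j"
    by linarith+
  from assms(2)[OF this, of f w] show ?thesis
    by (simp only: r poly_op_linear U_op_mult U_op_fvar diff_self)
qed

lemma U_op_urels:
  assumes "r \<in> urels n"
  shows "U_op r f w = 0"
  using assms unfolding urels_def
proof (elim UnE CollectE exE conjE)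
  assume "r \<in> serre_rels n E"
  then show ?thesis
    by (rule U_op_serre_rels[rotated -1]) (unfold op_gen.simps, erule opE_serre, erule (1) opE_commute)
next
  assume "r \<in> serre_rels n F"
  then show ?thesis
    by (rule U_op_serre_rels[rotated -1]) (unfold op_gen.simps, erule opF_serre, erule (1) opF_commute)
next
  fix i j assume r: "r = fvar (K i) * fvar (K j) - fvar (K j) * fvar (K i)"
  show ?thesis
    unfolding r poly_op_linear U_op_mult U_op_fvar by (simp only: op_gen.simps opD_opD mult.commute diff_self)
next
  fix i assume r: "r = fvar (K i) * fvar (Kinv i) - 1"
  show ?thesis
    unfolding r poly_op_linear U_op_mult U_op_fvar poly_op_one op_gen.simps opD_opD
    unfolding opD_def by (simp add: wt_eq_1)
next
  fix i assume r: "r = fvar (Kinv i) * fvar (K i) - 1"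
  show ?thesis
    unfolding r poly_op_linear U_op_mult U_op_fvar poly_op_one op_gen.simps opD_opD
    unfolding opD_def by (simp add: wt_eq_1)
next
  fix i j assume r: "r = fvar (E i) * fvar (F j) - fvar (F j) * fvar (E i)
        - (if i = j then
             fscale (1 / (v - v powi (- 1)))
               (fvar (K i) * fvar (Kinv (i + 1)) - fvar (Kinv i) * fvar (K (i + 1)))
           else 0)"
  have "U_op r f w = opE i (opF j f) w - opF j (opE i f) w
      - (if i = j then (wt (root_wt i) w - wt (\<lambda>a. inverse (root_wt i a)) w) / (v - inverse v) * f w else 0)"
  proof (cases "i = j")
    case True
    show ?thesis
      unfolding r if_P[OF True] poly_op_linear U_op_mult U_op_fvar op_gen.simps Suc_eq_plus1[symmetric] opD_K_Kinv
      by (simp add: power_int_minus left_diff_distrib)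
  next
    case False
    show ?thesis
      unfolding r if_not_P[OF False] poly_op_linear U_op_mult U_op_fvar poly_op_zero op_gen.simps ..
  qed
  then show ?thesis
    unfolding opE_opF_commutator by (rule trans) (rule diff_self)
next
  fix i j assume i: "i \<in> {1..n}" and r: "r = fvar (K i) * fvar (E j)
        - fscale (v powi (pairing n (eps i) (simple_root j))) (fvar (E j) * fvar (K i))"
  show ?thesis
    unfolding r poly_op_linear U_op_mult U_op_fvar pairing_eps[OF i] opK_opE[symmetric] op_gen.simps by (rule diff_self)
next
  fix i j assume i: "i \<in> {1..n}" and r: "r = fvar (K i) * fvar (F j)
        - fscale (v powi (- pairing n (eps i) (simple_root j))) (fvar (F j) * fvar (K i))"
  show ?thesis
    unfolding r poly_op_linear U_op_mult U_op_fvar pairing_eps[OF i] opK_opF[symmetric] op_gen.simps by (rule diff_self)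
qed


section \<open>The algebra \<open>1\<^sub>\<omega> S(n,n) 1\<^sub>\<omega>\<close>\<close>

lemma free_ideal_genideal:
  "R \<subseteq> carrier (free_alg X) \<Longrightarrow> free_ideal X (genideal (free_alg X :: ('k::comm_ring_1, 'x list \<Rightarrow>\<^sub>0 'k) module) R)"
  by (simp add: free_ideal_def ring.genideal_ideal[OF free_alg_ring])

lemma U_free_ideal: "free_ideal (ugens n) (genideal (free_alg (ugens n)) (urels n))"
  by (rule free_ideal_genideal[OF urels_closed])

abbreviation U_cls :: "nat \<Rightarrow> (ugen list \<Rightarrow>\<^sub>0 ratv) \<Rightarrow> (ugen list \<Rightarrow>\<^sub>0 ratv) set" where
  "U_cls n p \<equiv> genideal (free_alg (ugens n)) (urels n) +>\<^bsub>free_alg (ugens n)\<^esub> p"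

lemma U_carrier: "carrier (U n) = U_cls n ` carrier (free_alg (ugens n))"
  by (simp only: U_def presented_alg_def free_ideal.quot_alg_carrier[OF U_free_ideal])

lemmas U_ops_cls =
  free_ideal.quot_alg_ops[OF U_free_ideal, folded presented_alg_def U_def]
  free_ideal.quot_alg_one[OF U_free_ideal, folded presented_alg_def U_def]
  free_ideal.quot_alg_minus[OF U_free_ideal, folded presented_alg_def U_def]

text \<open>Representatives of one class act alike because the relations act as zero, so
  \<open>U_rep\<close> may be computed on any representative.\<close>

lemma U_rep_cls:
  assumes "p \<in> carrier (free_alg (ugens n))"
  shows "U_rep n d (U_cls n p) = word_mat n d (U_op p)"
proof -
  have eval: "free_eval (End_tens n d) (tens_rep n d) q = word_mat n d (U_op q)"
    if "q \<in> carrier (free_alg (ugens n))" for q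
    using free_eval_word_mat[of "ugens n" n d op_gen q, OF local_op_gen] that
    by (simp add: tens_rep_word_mat[abs_def])
  have "the_elem (free_eval (End_tens n d) (tens_rep n d) ` U_cls n p)
      = free_eval (End_tens n d) (tens_rep n d) p"
  proof (rule free_ideal.the_elem_image_cls[OF U_free_ideal _ assms])
    fix q assume q: "q \<in> carrier (free_alg (ugens n))"
      and qp: "q - p \<in> genideal (free_alg (ugens n)) (urels n)"
    have "U_op (q - p) f w = 0" for f w
      by (rule U_ops.poly_op_eq_0_on_genideal[OF conjI qp])
        (use urels_closed U_op_urels in blast)+
    then have "U_op q = U_op p"
      by (simp add: fun_eq_iff)
    then show "free_eval (End_tens n d) (tens_rep n d) q = free_eval (End_tens n d) (tens_rep n d) p"
      by (simp only: eval[OF q] eval[OF assms])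
  qed
  then show ?thesis
    by (simp only: U_rep_def eval[OF assms])
qed

lemma ordered_prod_U_cls:
  assumes "\<And>i. i \<in> set xs \<Longrightarrow> P i \<in> carrier (free_alg (ugens n))"
  shows "ordered_prod (U n) (map (\<lambda>i. U_cls n (P i)) xs) = U_cls n (foldr (*) (map P xs) 1) \<and>
     foldr (*) (map P xs) 1 \<in> carrier (free_alg (ugens n))"
  using assms
proof (induction xs)
  case Nil
  show ?case
    by (simp add: ordered_prod_def U_ops_cls)
next
  case (Cons i xs)
  then have "ordered_prod (U n) (map (\<lambda>i. U_cls n (P i)) xs) = U_cls n (foldr (*) (map P xs) 1)"
      "foldr (*) (map P xs) 1 \<in> carrier (free_alg (ugens n))" "P i \<in> carrier (free_alg (ugens n))"
    by simp_all
  then show ?case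
    by (simp add: ordered_prod_def U_ops_cls free_alg_closed' del: free_alg_simps(1))
qed

definition qK :: "nat \<Rightarrow> ugen list \<Rightarrow>\<^sub>0 ratv" where
  "qK i = fscale (1 / (v - inverse v)) (fvar (K i) - fvar (Kinv i))"

lemma qK_closed: "i \<in> {1..n} \<Longrightarrow> qK i \<in> carrier (free_alg (ugens n))"
  unfolding qK_def by (intro free_alg_closed' fvar_in_free_alg) simp_all

lemma poly_mapping_map_ident [simp]: "Poly_Mapping.map (\<lambda>a. a) p = p"
  by (rule poly_mapping_eqI) (simp add: map.rep_eq when_def)

lemma Kbinom_1:
  assumes "i \<in> {1..n}"
  shows "Kbinom n i 1 = U_cls n (qK i)"
proof -
  have i: "(fvar (K i) :: ugen list \<Rightarrow>\<^sub>0 ratv) \<in> carrier (free_alg (ugens n))"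
      "(fvar (Kinv i) :: ugen list \<Rightarrow>\<^sub>0 ratv) \<in> carrier (free_alg (ugens n))"
    using assms by simp_all
  have diff: "(fvar (K i) - fvar (Kinv i) :: ugen list \<Rightarrow>\<^sub>0 ratv) \<in> carrier (free_alg (ugens n))"
    by (rule free_alg_closed'(2)[OF i])
  have "Kbinom n i 1 = ((1 / (v - inverse v)) \<odot>\<^bsub>U n\<^esub> (1 \<odot>\<^bsub>U n\<^esub> U_cls n (fvar (K i))
      \<ominus>\<^bsub>U n\<^esub> 1 \<odot>\<^bsub>U n\<^esub> U_cls n (fvar (Kinv i)))) \<otimes>\<^bsub>U n\<^esub> \<one>\<^bsub>U n\<^esub>"
    by (simp add: Kbinom_def ugen_class_def presented_gen_def ordered_prod_def power_int_minus)
  also have "\<dots> = U_cls n (qK i)"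
    unfolding U_ops_cls(3)[OF i(1)] U_ops_cls(3)[OF i(2)] U_ops_cls(4) mult_1 poly_mapping_map_ident
      U_ops_cls(5)[OF i] U_ops_cls(3)[OF diff] qK_def[symmetric]
      U_ops_cls(2)[OF qK_closed[OF assms] free_alg_closed'(5)]
    by simp
  finally show ?thesis .
qed

definition q_omega :: "nat \<Rightarrow> ugen list \<Rightarrow>\<^sub>0 ratv" where
  "q_omega n = foldr (*) (map qK [1..<Suc n]) 1"

lemma wt_elem_omega:
  "wt_elem n omega = U_cls n (q_omega n)" "q_omega n \<in> carrier (free_alg (ugens n))"
proof -
  have "\<And>i. i \<in> set [1..<Suc n] \<Longrightarrow> qK i \<in> carrier (free_alg (ugens n))"
    by (rule qK_closed) auto
  note prod = ordered_prod_U_cls[of "[1..<Suc n]" qK n, OF this, folded q_omega_def]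
  have "map (\<lambda>i. Kbinom n i (omega i)) [1..<Suc n] = map (\<lambda>i. U_cls n (qK i)) [1..<Suc n]"
    by (intro map_cong refl) (simp add: omega_def Kbinom_1[unfolded One_nat_def] del: upt_Suc)
  then show "wt_elem n omega = U_cls n (q_omega n)"
    using prod by (simp only: wt_elem_def)
  show "q_omega n \<in> carrier (free_alg (ugens n))"
    using prod by (rule conjunct2)
qed

definition perms :: "nat \<Rightarrow> nat list set" where
  "perms n = {w. distinct w \<and> set w = {1..n}}"

lemma perms_subset_words: "perms n \<subseteq> words n n"
  using distinct_card by (fastforce simp: perms_def words_def)

definition proj :: "nat \<Rightarrow> oper" where
  "proj n f w = (if w \<in> perms n then f w else 0)"

lemma proj_proj [simp]: "proj n (proj n f) = proj n f"
  by (auto simp: proj_def)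

lemma local_op_proj: "local_op n n (proj n)"
  using perms_subset_words[of n] by (auto simp: local_op_def linop_def proj_def fun_eq_iff)

lemma wt_single_letter:
  "i \<notin> set w \<Longrightarrow> wt (\<lambda>a. if a = i then x else 1) w = 1"
  "distinct w \<Longrightarrow> i \<in> set w \<Longrightarrow> wt (\<lambda>a. if a = i then x else 1) w = x"
  by (induction w) (auto simp: wt_eq_1)

lemma v_neq_inverse: "v \<noteq> inverse v"
  using v_minus_inverse_neq_0 by auto

lemma U_op_q_omega:
  assumes "w \<in> words n n"
  shows "U_op (q_omega n) f w = proj n f w"
proof -
  \<comment> \<open>This is the quantum integer of the number of letters \<open>i\<close> in
    \<open>w\<close>: 1 for a single occurrence and 0 for none.\<close>
  define m where "m i = (wt (\<lambda>a. if a = i then v else 1) w - wt (\<lambda>a. if a = i then inverse v else 1) w)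
      / (v - inverse v)" for i
  have qK: "U_op (qK i) g w = m i * g w" for i g
    unfolding qK_def poly_op_linear U_op_fvar op_gen.simps opD_def m_def
    by (simp add: left_diff_distrib)
  have prod: "U_op (foldr (*) (map qK xs) 1) g w = prod_list (map m xs) * g w" for xs g
    by (induction xs) (simp_all add: U_op_mult qK)
  have "prod_list (map m [1..<Suc n]) = (if w \<in> perms n then 1 else 0)"
  proof (cases "w \<in> perms n")
    case True
    then have "map m [1..<Suc n] = map (\<lambda>_. 1) [1..<Suc n]"
      by (intro map_cong refl) (simp add: m_def perms_def wt_single_letter v_neq_inverse del: upt_Suc)
    then show ?thesis
      using True by (simp only: if_True) (simp add: map_replicate_const)
  next
    case False
    \<comment> \<open>A word of length \<open>n\<close> that is not a permutation misses a letter,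
      and the factor of that letter vanishes.\<close>
    have "\<not> {1..n} \<subseteq> set w"
    proof
      assume sub: "{1..n} \<subseteq> set w"
      then have "set w = {1..n}"
        using assms by (auto simp: words_def)
      moreover from this have "distinct w"
        using assms by (intro card_distinct) (simp add: words_def)
      ultimately show False
        using False by (simp add: perms_def)
    qed
    then obtain i where i: "i \<in> {1..n}" "i \<notin> set w"
      by blast
    then have "m i = 0"
      by (simp add: m_def wt_single_letter)
    then have "0 \<in> set (map m [1..<Suc n])"
      using i(1) by (auto simp del: upt_Suc simp: image_iff intro!: bexI[of _ i])
    then show ?thesis
      using False by (simp only: prod_list_zero_iff if_False)
  qed
  then show ?thesis
    by (simp add: q_omega_def prod proj_def del: upt_Suc)
qed

section \<open>The Schur algebra and its corner as algebras of operators\<close>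

lemma Schur_simps [simp]:
  "monoid.mult (Schur n d) = (*)" "one (Schur n d) = 1\<^sub>m (n ^ d)"
  "zero (Schur n d) = 0\<^sub>m (n ^ d) (n ^ d)"
  "add (Schur n d) = (+)" "smult (Schur n d) = (\<cdot>\<^sub>m)"
  by (simp_all add: Schur_def)

lemma Schur_carrier: "carrier (Schur n d) = (\<lambda>p. word_mat n d (U_op p)) ` carrier (free_alg (ugens n))"
  by (simp add: Schur_def U_carrier image_image U_rep_cls cong: image_cong_simp del: free_alg_simps(1))

lemma one_omega_proj: "one_omega n = word_mat n n (proj n)"
  by (simp add: one_omega_def wt_elem_omega U_rep_cls word_mat_eq_iff U_op_q_omega del: free_alg_simps(1))

lemma local_U_op: "p \<in> carrier (free_alg (ugens n)) \<Longrightarrow> local_op n d (U_op p)"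
  by (rule local_poly_op) (auto simp: local_op_gen)

lemma corner_Schur_simps [simp]:
  "monoid.mult (corner_Schur n) = (*)" "one (corner_Schur n) = word_mat n n (proj n)"
  "zero (corner_Schur n) = 0\<^sub>m (n ^ n) (n ^ n)"
  "add (corner_Schur n) = (+)" "smult (corner_Schur n) = (\<cdot>\<^sub>m)"
  by (simp_all add: corner_Schur_def corner_def one_omega_proj)

definition corner_mat :: "nat \<Rightarrow> (ugen list \<Rightarrow>\<^sub>0 ratv) \<Rightarrow> ratv mat" where
  "corner_mat n p = word_mat n n (\<lambda>f. proj n (U_op p (proj n f)))"

lemma word_mat_comp3:
  assumes "local_op n n X"
  shows "word_mat n n (proj n) * word_mat n n X * word_mat n n (proj n)
     = word_mat n n (\<lambda>f. proj n (X (proj n f)))"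
  using word_mat_comp[OF local_op_proj, of n X] word_mat_comp[OF local_op_comp[OF local_op_proj assms], of "proj n"]
  by simp

lemma corner_Schur_carrier:
  "carrier (corner_Schur n) = corner_mat n ` carrier (free_alg (ugens n))"
proof -
  have "carrier (corner_Schur n) =
      (\<lambda>x. word_mat n n (proj n) * x * word_mat n n (proj n)) ` carrier (Schur n n)"
    by (auto simp: corner_Schur_def corner_def one_omega_proj)
  also have "\<dots> = corner_mat n ` carrier (free_alg (ugens n))"
    unfolding Schur_carrier image_image corner_mat_def
    by (rule image_cong[OF refl]) (rule word_mat_comp3[OF local_U_op])
  finally show ?thesis .
qed

definition opT :: "nat \<Rightarrow> nat \<Rightarrow> oper" where
  "opT n i f = proj n (opE i (opF i (proj n f)))"

lemma tgen_opT:
  assumes "i \<in> {1..<n}"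
  shows "tgen n i = word_mat n n (opT n i)" "tgen n i = corner_mat n (fvar (E i) * fvar (F i))"
proof -
  have E: "U_rep n n (ugen_class n g) = word_mat n n (op_gen g)" if "g \<in> ugens n" for g
    unfolding ugen_class_def presented_gen_def
    using U_rep_cls[of "fvar g" n n] that by (simp add: U_op_fvar)
  have loc: "local_op n n (opE i)" "local_op n n (opF i)"
    using local_op_gen[of "E i"] local_op_gen[of "F i"] assms by simp_all
  note comp = local_op_comp[OF local_op_proj loc(1)]
  have "tgen n i = word_mat n n (proj n) * word_mat n n (opE i) * word_mat n n (opF i) * word_mat n n (proj n)"
    using E[of "E i"] E[of "F i"] assms by (simp add: tgen_def one_omega_proj)
  also have "\<dots> = word_mat n n (\<lambda>f. proj n (opE i (opF i (proj n f))))"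
    by (simp only: word_mat_comp[OF local_op_proj, symmetric] word_mat_comp[OF comp, symmetric]
      word_mat_comp[OF local_op_comp[OF comp loc(2)], symmetric])
  finally show "tgen n i = word_mat n n (opT n i)"
    by (simp add: opT_def[abs_def])
  then show "tgen n i = corner_mat n (fvar (E i) * fvar (F i))"
    by (simp add: opT_def[abs_def] corner_mat_def U_op_mult U_op_fvar)
qed


section \<open>Hecke operators on the \<open>\<omega>\<close> weight space\<close>

definition pos :: "nat list \<Rightarrow> nat \<Rightarrow> nat" where
  "pos w x = length (takeWhile (\<lambda>y. y \<noteq> x) w)"

text \<open>Letters are exchanged here, wherever they stand. Exchanges of places belong to the
  commuting action, which appears below as \<open>opR\<close>.\<close>

definition sw :: "nat \<Rightarrow> nat list \<Rightarrow> nat list" where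
  "sw i = map (transpose i (Suc i))"

lemma pos_eq_iff:
  assumes "x \<in> set w" "y \<in> set w"
  shows "pos w x = pos w y \<longleftrightarrow> x = y"
proof -
  have "w ! pos w z = z" if "z \<in> set w" for z
    using that by (induction w) (auto simp: pos_def)
  then show ?thesis
    using assms by metis
qed

lemma pos_sw: "pos (sw i w) x = pos w (transpose i (Suc i) x)"
proof -
  have "(transpose i (Suc i) y \<noteq> x) = (y \<noteq> transpose i (Suc i) x)" for y
    by (metis transpose_involutory)
  then show ?thesis
    by (simp only: pos_def sw_def takeWhile_map comp_def length_map)
qed

lemma sw_sw [simp]: "sw i (sw i w) = w"
  by (simp add: sw_def)

lemma sw_commute: "j \<noteq> Suc i \<Longrightarrow> i \<noteq> Suc j \<Longrightarrow> sw i (sw j w) = sw j (sw i w)"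
  by (auto simp: sw_def transpose_def)

lemma sw_braid: "sw (Suc i) (sw i (sw (Suc i) w)) = sw i (sw (Suc i) (sw i w))"
  by (auto simp: sw_def transpose_def)

lemma sw_perms [simp]:
  assumes "i \<in> {1..<n}"
  shows "sw i w \<in> perms n \<longleftrightarrow> w \<in> perms n"
proof -
  have "sw i w \<in> perms n" if "w \<in> perms n" for w
  proof -
    have "transpose i (Suc i) ` {1..n} = {1..n}"
      using assms by (intro transpose_image_eq) auto
    then show ?thesis
      using that by (simp add: sw_def perms_def distinct_map)
  qed
  from this[of w] this[of "sw i w"] show ?thesis
    by auto
qed

lemma opE_absent: "i \<notin> set w \<Longrightarrow> opE i f w = 0"
  by (induction w arbitrary: f) auto

lemma opE_skip: "i \<notin> set xs \<Longrightarrow> opE i f (xs @ w) = opE i (\<lambda>u. f (xs @ u)) w"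
  by (induction xs arbitrary: f) auto

lemma opF_absent: "Suc i \<notin> set w \<Longrightarrow> opF i f w = 0"
  by (induction w arbitrary: f) auto

text \<open>In contrast to \<open>opE\<close>, the recursion of \<open>opF\<close> picks up inverse
  root weights of the letters on the left, so these must be free of \<open>Suc i\<close> as
  well.\<close>

lemma opF_skip: "i \<notin> set xs \<Longrightarrow> Suc i \<notin> set xs \<Longrightarrow> opF i f (xs @ w) = opF i (\<lambda>u. f (xs @ u)) w"
  by (induction xs arbitrary: f) (auto simp: root_wt_def)

lemma perms_split:
  assumes "w \<in> perms n" "i \<in> {1..<n}"
  obtains xs ys zs a b where "w = xs @ a # ys @ b # zs" "{a, b} = {i, Suc i}"
    "i \<notin> set xs" "Suc i \<notin> set xs" "i \<notin> set ys" "Suc i \<notin> set ys" "i \<notin> set zs" "Suc i \<notin> set zs"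
proof -
  have "i \<in> set w" "Suc i \<in> set w" "distinct w"
    using assms by (auto simp: perms_def)
  then obtain xs zs where w: "w = xs @ i # zs"
    by (meson split_list)
  show ?thesis
  proof (cases "Suc i \<in> set xs")
    case True
    then obtain us vs where "xs = us @ Suc i # vs"
      by (meson split_list)
    then show ?thesis
      using that[of us "Suc i" vs i zs] \<open>distinct w\<close> w by auto
  next
    case False
    then have "Suc i \<in> set zs"
      using \<open>Suc i \<in> set w\<close> w by auto
    then obtain us vs where "zs = us @ Suc i # vs"
      by (meson split_list)
    then show ?thesis
      using that[of xs i us "Suc i" vs] \<open>distinct w\<close> w by auto
  qed
qed

text \<open>\<open>opE\<close> reads the word in which \<open>i\<close> has become a second
  \<open>Suc i\<close>, and \<open>opF\<close> turns either of the two back, which yields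
  \<open>f w\<close> and \<open>f (sw i w)\<close>. If \<open>i\<close> stands on the left, the
  weight of the tail gives 1/v to both terms and passing the first \<open>Suc i\<close> gives v to
  the second. If \<open>i\<close> stands on the right, the tail gives 1 and the factor v falls on
  \<open>f w\<close>.\<close>

lemma opE_opF_on_perms:
  assumes "w \<in> perms n" "i \<in> {1..<n}"
  shows "opE i (opF i f) w = (if pos w i < pos w (Suc i) then inverse v else v) * f w + f (sw i w)"
proof -
  obtain xs ys zs a b where w: "w = xs @ a # ys @ b # zs" and ab: "{a, b} = {i, Suc i}"
    and fresh: "i \<notin> set xs" "Suc i \<notin> set xs" "i \<notin> set ys" "Suc i \<notin> set ys" "i \<notin> set zs" "Suc i \<notin> set zs"
    by (rule perms_split[OF assms])
  have id: "map (transpose i (Suc i)) us = us" "wt (root_wt i) us = 1"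
    if "i \<notin> set us" "Suc i \<notin> set us" for us
    using that by (auto intro!: map_idI wt_eq_1 transpose_apply_other simp: root_wt_def)
  have pos: "pos (us @ x # vs) x = length us" "y \<notin> set us \<Longrightarrow> y \<noteq> x \<Longrightarrow> length us < pos (us @ x # vs) y"
    if "x \<notin> set us" for us x vs y
    using that by (auto simp: pos_def takeWhile_append)
  consider "a = i" "b = Suc i" | "a = Suc i" "b = i"
    using ab by (auto simp: doubleton_eq_iff)
  then show ?thesis
  proof cases
    case 1
    have "pos w i < pos w (Suc i)"
      using fresh pos(1)[of i xs] pos(2)[of i xs "Suc i"] by (simp add: w 1)
    then show ?thesis
      using fresh by (simp add: w 1 sw_def id opE_skip opE_absent opF_skip opF_absent root_wt_def
        distrib_left v_cancel)
  next
    case 2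
    have "\<not> pos w i < pos w (Suc i)"
      using fresh pos(1)[of "Suc i" xs] pos(2)[of "Suc i" xs i "ys @ i # zs"] by (simp add: w 2)
    then show ?thesis
      using fresh by (simp add: w 2 sw_def id opE_skip opE_absent opF_skip opF_absent root_wt_def)
  qed
qed

locale hecke_op =
  fixes n :: nat and c1 c2 b :: ratv
begin

definition cf :: "nat \<Rightarrow> nat list \<Rightarrow> ratv" where
  "cf i w = (if pos w i < pos w (Suc i) then c1 else c2)"

text \<open>The inner \<open>proj\<close> keeps \<open>G i\<close> inside the weight space for every
  index, also where \<open>sw i\<close> leads out of \<open>perms n\<close>; the locale
  \<open>op_assignment\<close> quantifies over all indices.\<close>

definition G :: "nat \<Rightarrow> oper" where
  "G i f w = (if w \<in> perms n then cf i w * f w + b * proj n f (sw i w) else 0)"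

sublocale op_assignment "proj n" G
  by standard
    (auto simp: linop_def proj_def G_def fun_eq_iff algebra_simps)

context
  fixes i assumes i: "i \<in> {1..<n}"
begin

lemma G_eq: "w \<in> perms n \<Longrightarrow> G i f w = cf i w * f w + b * f (sw i w)"
  using i by (simp add: G_def proj_def)

lemma cf_cases:
  assumes "w \<in> perms n"
  obtains "cf i w = c1" "cf i (sw i w) = c2" | "cf i w = c2" "cf i (sw i w) = c1"
proof -
  have "pos w i \<noteq> pos w (Suc i)"
    using assms i by (subst pos_eq_iff) (auto simp: perms_def)
  then show ?thesis
    using that by (cases "pos w i < pos w (Suc i)") (auto simp: cf_def pos_sw)
qed

text \<open>Cayley-Hamilton for the matrix with trace c1 + c2 and determinant c1 c2 - b^2.\<close>

lemma G_square: "G i (G i f) w = (c1 + c2) * G i f w + (b * b - c1 * c2) * proj n f w"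
proof (cases "w \<in> perms n")
  case True
  then have "sw i w \<in> perms n"
    using i by simp
  then show ?thesis
    using True by (cases rule: cf_cases[OF True]) (simp_all add: G_eq proj_def algebra_simps)
qed (simp add: G_def proj_def)

lemma G_commute:
  assumes "j \<in> {1..<n}" "j \<noteq> i" "j \<noteq> Suc i" "i \<noteq> Suc j"
  shows "G i (G j f) w = G j (G i f) w"
proof (cases "w \<in> perms n")
  case True
  then have "sw i w \<in> perms n" "sw j w \<in> perms n"
    using i assms(1) by simp_all
  moreover have "cf i (sw j w) = cf i w" "cf j (sw i w) = cf j w"
    using assms by (simp_all add: cf_def pos_sw transpose_apply_other)
  ultimately show ?thesis
    using True assms G_eq hecke_op.G_eq[OF assms(1), folded G_def]
    by (simp add: G_def proj_def algebra_simps sw_commute i)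
qed (simp add: G_def)

lemma G_braid:
  assumes j: "Suc i \<in> {1..<n}"
  shows "G i (G (Suc i) (G i f)) w - G (Suc i) (G i (G (Suc i) f)) w
    = c1 * c2 * (G i f w - G (Suc i) f w)"
proof (cases "w \<in> perms n")
  case True
  have tr: "transpose i (Suc i) (Suc (Suc i)) = Suc (Suc i)" "transpose (Suc i) (Suc (Suc i)) i = i"
    by (simp_all add: transpose_def)
  have "pos w i \<noteq> pos w (Suc i)" "pos w (Suc i) \<noteq> pos w (Suc (Suc i))" "pos w i \<noteq> pos w (Suc (Suc i))"
    using True i j by (subst pos_eq_iff; force simp: perms_def)+
  \<comment> \<open>All coefficients depend only on the order of the places of the three letters.
    Two of the eight combinations of comparisons are cyclic and hence contradictory; the others are
    the six orders.\<close>
  then show ?thesis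
    using True i j
    by (cases "pos w i < pos w (Suc i)"; cases "pos w (Suc i) < pos w (Suc (Suc i))";
        cases "pos w i < pos w (Suc (Suc i))")
      (simp_all add: G_def proj_def cf_def pos_sw tr sw_braid algebra_simps)
qed (simp add: G_def)

end

end

interpretation t_op: hecke_op n "inverse v" v 1 for n .

lemma opT_eq_G:
  assumes "i \<in> {1..<n}"
  shows "opT n i = t_op.G n i"
proof (intro ext)
  fix f w
  show "opT n i f w = t_op.G n i f w"
    using assms opE_opF_on_perms[of w n i "proj n f"]
    by (simp add: opT_def t_op.G_def t_op.cf_def proj_def)
qed


section \<open>Operators commuting with \<open>U\<close>\<close>

text \<open>The action of \<open>U\<close> commutes with a Hecke algebra acting on the positions in a word. An element
  of \<open>1\<^sub>\<omega> S(n,n) 1\<^sub>\<omega>\<close> is therefore determined by its value at one word of weight \<open>\<omega>\<close>.\<close>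

definition rc :: "nat \<Rightarrow> nat \<Rightarrow> ratv" where
  "rc a b = (if a < b then v else if b < a then inverse v else 1)"

text \<open>At the places \<open>k\<close> and \<open>k + 1\<close>, counted from 0, this is [2]
  times the projection of V tensor V onto the quantum exterior square. It is 0 on words without
  these places.\<close>

primrec opR :: "nat \<Rightarrow> oper" where
  "opR 0 f w = (case w of a # b # u \<Rightarrow> rc a b * f (a # b # u) - f (b # a # u) | _ \<Rightarrow> 0)"
| "opR (Suc k) f w = (case w of [] \<Rightarrow> 0 | a # u \<Rightarrow> opR k (\<lambda>x. f (a # x)) u)"

lemma opR_linear_at:
  "opR k (\<lambda>w. 0) w = 0"
  "opR k (\<lambda>w. f w + g w) w = opR k f w + opR k g w"
  "opR k (\<lambda>w. c * f w) w = c * opR k f w"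
  by (induction k arbitrary: f g w) (simp_all add: algebra_simps split: list.split)

lemma opR_linear:
  "opR k (\<lambda>w. 0) = (\<lambda>w. 0)"
  "opR k (\<lambda>w. f w + g w) = (\<lambda>w. opR k f w + opR k g w)"
  "opR k (\<lambda>w. c * f w) = (\<lambda>w. c * opR k f w)"
  by (rule ext, simp only: opR_linear_at)+

lemma linop_opR: "linop (opR k)"
  by (simp add: linop_def opR_linear)

text \<open>The weight depends only on the multiset of letters, which an exchange of places
  preserves.\<close>

lemma opR_wt: "opR k (\<lambda>u. wt mu u * f u) w = wt mu w * opR k f w"
proof (induction k arbitrary: f w)
  case (Suc k)
  then show ?case
    by (simp add: opR_linear mult.assoc split: list.split)
qed (simp add: algebra_simps split: list.split)

text \<open>For \<open>k = 0\<close> this is a computation with two letters. In the step the tail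
  weight in \<open>opE\<close> passes \<open>opR\<close> by \<open>opR_wt\<close>.\<close>

lemma opE_opR: "opE i (opR k f) w = opR k (opE i f) w"
proof (induction k arbitrary: f w)
  case 0
  have diff: "opE i (\<lambda>w. f w - g w) w = opE i f w - opE i g w" for f g w
    using linop_diff[of "opE i"] op_gen_linop[of "E i"] by simp
  show ?case
  proof (cases w rule: remdups_adj.cases)
    case (3 a b u)
    then show ?thesis
      by (auto simp: diff opE_linear rc_def root_wt_def algebra_simps v_cancel)
  qed simp_all
next
  case (Suc k)
  show ?case
    by (cases w) (simp_all add: opR_linear opR_wt Suc.IH)
qed

lemma opF_opR: "opF i (opR k f) w = opR k (opF i f) w"
proof (induction k arbitrary: f w)
  case 0
  have diff: "opF i (\<lambda>w. f w - g w) w = opF i f w - opF i g w" for f g w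
    using linop_diff[of "opF i"] op_gen_linop[of "F i"] by simp
  show ?case
  proof (cases w rule: remdups_adj.cases)
    case (3 a b u)
    then show ?thesis
      by (auto simp: diff opF_linear rc_def root_wt_def algebra_simps v_cancel)
  qed simp_all
next
  case (Suc k)
  show ?case
    by (cases w) (simp_all add: opR_linear Suc.IH)
qed

lemma U_op_opR: "U_op p (opR k f) w = opR k (U_op p f) w"
proof -
  have gen: "op_gen g (opR k f) = opR k (op_gen g f)" for g f
    by (cases g) (auto simp: fun_eq_iff opE_opR opF_opR opD_def[abs_def] opR_wt)
  have word: "op_word (\<lambda>f. f) op_gen xs (opR k f) = opR k (op_word (\<lambda>f. f) op_gen xs f)" for xs f
    by (induction xs) (simp_all add: gen)
  show ?thesis
    by (simp add: poly_op_def[abs_def] word linop_sum[OF linop_opR])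
qed

lemma opR_short: "length w \<le> Suc k \<Longrightarrow> opR k f w = 0"
proof (induction k arbitrary: f w)
  case 0
  then show ?case
    by (cases w rule: remdups_adj.cases) simp_all
next
  case (Suc k)
  then show ?case
    by (cases w) simp_all
qed

lemma opR_append: "opR (length xs) f (xs @ a # b # ys) = rc a b * f (xs @ a # b # ys) - f (xs @ b # a # ys)"
  by (induction xs arbitrary: f) simp_all

text \<open>The formula for \<open>opR\<close> on a basis vector, solved for the vector of the
  exchanged word. An operator that commutes with \<open>opR\<close> can thus be transported from a
  word to its neighbours.\<close>

lemma delta_swap:
  "delta (xs @ b # a # ys) w = rc a b * delta (xs @ a # b # ys) w - opR (length xs) (delta (xs @ a # b # ys)) w"
proof (cases "length w \<le> Suc (length xs)")
  case True
  then have "delta (xs @ c # d # ys) w = 0" for c d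
    by (auto simp: delta_def)
  then show ?thesis
    by (simp only: opR_short[OF True])
next
  case False
  then have "2 \<le> length (drop (length xs) w)"
    by simp
  then obtain c d zs where drop: "drop (length xs) w = c # d # zs"
    by (metis Suc_le_length_iff numeral_2_eq_2)
  define us where "us = take (length xs) w"
  have len: "length us = length xs"
    using False by (simp add: us_def)
  have w: "w = us @ c # d # zs"
    unfolding us_def drop[symmetric] by simp
  have R: "opR (length xs) f w = rc c d * f (us @ c # d # zs) - f (us @ d # c # zs)" for f
    unfolding w len[symmetric] by (rule opR_append)
  have eq: "delta (xs @ a' # b' # ys) (us @ c' # d' # zs)
      = (if us = xs \<and> zs = ys \<and> c' = a' \<and> d' = b' then 1 else 0)" for a' b' c' d'
    using len by (auto simp: delta_def)
  have comm: "(us = xs \<and> zs = ys \<and> d = a \<and> c = b) = (us = xs \<and> zs = ys \<and> c = b \<and> d = a)"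
    by blast
  show ?thesis
  proof (cases "us = xs \<and> zs = ys \<and> c = a \<and> d = b")
    case True
    then have "c = a" "d = b"
      by simp_all
    then show ?thesis
      unfolding R unfolding w eq if_P[OF True] comm by (simp split del: if_split)
  next
    case False
    show ?thesis
      unfolding R unfolding w eq if_not_P[OF False] comm by (simp split del: if_split)
  qed
qed

text \<open>The first letter of \<open>w'\<close> is moved to the front of \<open>w\<close> by
  exchanges of neighbours and then joins the fixed prefix \<open>zs\<close>.\<close>

lemma adjacent_swaps_reach:
  assumes swap: "\<And>xs a b ys. Q (xs @ a # b # ys) \<Longrightarrow> Q (xs @ b # a # ys)"
  shows "mset w = mset w' \<Longrightarrow> Q (zs @ w) \<Longrightarrow> Q (zs @ w')"
proof (induction w' arbitrary: w zs)
  case (Cons y w')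
  have move: "Q (zs @ y # us @ vs)" if "Q (zs @ us @ y # vs)" for us vs
    using that
  proof (induction us arbitrary: vs rule: rev_induct)
    case (snoc x us)
    then show ?case
      using swap[of "zs @ us" x y vs] by simp
  qed simp
  have "y \<in> set w"
    using Cons.prems(1) by (metis list.set_intros(1) set_mset_mset)
  then obtain us vs where w: "w = us @ y # vs"
    by (meson split_list)
  then have "mset (us @ vs) = mset w'"
    using Cons.prems(1) by simp
  then show ?case
    using Cons.IH[of "us @ vs" "zs @ [y]"] move[of us vs] Cons.prems(2) w by simp
qed simp

lemma perms_length: "w \<in> perms n \<Longrightarrow> length w = n"
  using perms_subset_words by (auto simp: words_def)

lemma perms_mset: "w \<in> perms n \<Longrightarrow> u \<in> perms n \<Longrightarrow> mset w = mset u"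
  by (simp add: perms_def set_eq_iff_mset_eq_distinct[symmetric])

text \<open>Vanishing at one permutation spreads to all others along \<open>delta_swap\<close>,
  because \<open>U_op p\<close> commutes with \<open>opR\<close>.\<close>

lemma U_op_determined:
  assumes "w0 \<in> perms n" and "\<And>w. w \<in> perms n \<Longrightarrow> U_op p (delta w0) w = 0"
    and "u \<in> perms n" and "w \<in> perms n"
  shows "U_op p (delta u) w = 0"
proof -
  let ?Q = "\<lambda>u. u \<in> perms n \<and> (\<forall>w\<in>perms n. U_op p (delta u) w = 0)"
  have "?Q ([] @ u)"
  proof (rule adjacent_swaps_reach[where Q = ?Q])
    fix xs a b ys assume Q: "?Q (xs @ a # b # ys)"
    let ?u = "xs @ a # b # ys" and ?u' = "xs @ b # a # ys"
    have lin: "U_op p (delta ?u') = (\<lambda>w. rc a b * U_op p (delta ?u) w - opR (length xs) (U_op p (delta ?u)) w)"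
    proof -
      have "delta ?u' = (\<lambda>w. rc a b * delta ?u w - opR (length xs) (delta ?u) w)"
        by (rule ext, rule delta_swap)
      then show ?thesis
        by (simp add: linop_diff[OF U_ops.linop_poly_op] linop_cmult[OF U_ops.linop_poly_op] U_op_opR)
    qed
    have "U_op p (delta ?u') w = 0" if "w \<in> perms n" for w
    proof -
      have "length w = length ?u"
        using that Q perms_length by metis
      define us where "us = take (length xs) w"
      have "length (drop (length xs) w) = Suc (Suc (length ys))"
        using \<open>length w = _\<close> by simp
      then obtain c d zs where drop: "drop (length xs) w = c # d # zs"
        by (metis length_Suc_conv)
      have w: "w = us @ c # d # zs"
        unfolding us_def drop[symmetric] by simp
      have len: "length xs = length us"
        using \<open>length w = _\<close> by (simp add: us_def)
      \<comment> \<open>At \<open>w\<close> the operator \<open>opR\<close> reads only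
        \<open>w\<close> and this word; both are permutations, where the old value is 0.\<close>
      have "us @ d # c # zs \<in> perms n"
        using that by (auto simp: w perms_def)
      then show ?thesis
        using Q that unfolding lin len w opR_append by simp
    qed
    moreover have "?u' \<in> perms n"
      using Q by (auto simp: perms_def)
    ultimately show "?Q ?u'"
      by blast
  next
    show "mset w0 = mset u"
      by (rule perms_mset[OF assms(1,3)])
    show "?Q ([] @ w0)"
      using assms(1,2) by simp
  qed
  then show ?thesis
    using assms(4) by simp
qed

text \<open>Conjugation builds every transposition of letters from neighbouring ones, and
  transpositions build every permutation of the letters of 1 2 ... n.\<close>

lemma sw_reach:
  assumes base: "Q [1..<Suc n]"
    and step: "\<And>i u. i \<in> {1..<n} \<Longrightarrow> u \<in> perms n \<Longrightarrow> Q u \<Longrightarrow> Q (sw i u)"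
    and u: "u \<in> perms n"
  shows "Q u"
proof -
  let ?Q = "\<lambda>u. u \<in> perms n \<and> Q u"
  have step': "?Q (sw i u)" if "i \<in> {1..<n}" "?Q u" for i u
    using that step by simp
  have transpose_less: "?Q (map (transpose a b) u)" if "a < b" "1 \<le> a" "b \<le> n" "?Q u" for a b u
    using that(1,3,4)
  proof (induction b arbitrary: u)
    case (Suc b)
    show ?case
    proof (cases "a = b")
      case True
      then show ?thesis
        using step'[of a u] Suc.prems that(2) by (simp add: sw_def)
    next
      case False
      then have "a < b"
        using Suc.prems by simp
      then have "transpose a (Suc b) = transpose b (Suc b) \<circ> transpose a b \<circ> transpose b (Suc b)"
        by (auto simp: transpose_def fun_eq_iff)
      then have "map (transpose a (Suc b)) u = sw b (map (transpose a b) (sw b u))"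
        by (simp add: sw_def)
      moreover have "b \<in> {1..<n}"
        using \<open>a < b\<close> that(2) Suc.prems(2) by simp
      ultimately show ?thesis
        using step' Suc.IH[OF \<open>a < b\<close>] Suc.prems by simp
    qed
  qed simp
  have transpose: "?Q (map (transpose a b) u)" if "a \<in> {1..n}" "b \<in> {1..n}" "?Q u" for a b u
    using transpose_less[of a b u] transpose_less[of b a u] that
    by (cases a b rule: linorder_cases) (auto simp: transpose_commute)
  have w0: "[1..<Suc n] \<in> perms n"
    by (auto simp: perms_def)
  have "?Q (map p [1..<Suc n])" if "p permutes {1..n}" for p
    using that finite_atLeastAtMost
  proof (induction p rule: permutes_induct)
    case id
    show ?case
      using base w0 by simp
  next
    case (swap a b p)
    show ?case
      unfolding map_map[symmetric] by (rule transpose) fact+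
  qed
  moreover define p where "p x = (if x \<in> {1..n} then u ! (x - 1) else x)" for x
  have len: "length u = n"
    using u perms_subset_words by (auto simp: words_def)
  have up: "u = map p [1..<Suc n]"
    by (rule nth_equalityI) (simp_all add: len p_def del: upt_Suc)
  moreover have "p permutes {1..n}"
  proof (rule bij_imp_permutes)
    have "distinct (map p [1..<Suc n])" "set (map p [1..<Suc n]) = {1..n}"
      using u unfolding up[symmetric] by (simp_all add: perms_def)
    then show "bij_betw p {1..n} {1..n}"
      by (simp add: bij_betw_def distinct_map atLeastLessThanSuc_atLeastAtMost del: upt_Suc)
  qed (auto simp: p_def)
  ultimately show ?thesis
    by metis
qed

section \<open>Basis vectors reached from the word 1 2 ... n\<close>

context hecke_op
begin

abbreviation H_op :: "(nat list \<Rightarrow>\<^sub>0 ratv) \<Rightarrow> oper" where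
  "H_op \<equiv> poly_op (proj n) G"

lemma G_delta:
  assumes i: "i \<in> {1..<n}" and u: "u \<in> perms n"
  shows "G i (delta u) w = cf i u * delta u w + b * delta (sw i u) w"
proof -
  have "sw i w = u \<longleftrightarrow> w = sw i u"
    by (metis sw_sw)
  moreover have "w \<in> perms n" if "w = u \<or> w = sw i u"
    using that i u by auto
  ultimately show ?thesis
    using i by (auto simp: G_def proj_def delta_def)
qed

lemma delta_reached:
  assumes b: "b \<noteq> 0" and u: "u \<in> perms n"
  shows "\<exists>p \<in> carrier (free_alg {1..<n}). H_op p (delta [1..<Suc n]) = delta u"
  using u
proof (induction rule: sw_reach[rotated -1, consumes 1, case_names base step])
  case base
  have "[1..<Suc n] \<in> perms n"
    by (auto simp: perms_def)
  then have "H_op 1 (delta [1..<Suc n]) = delta [1..<Suc n]"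
    by (auto simp: proj_def delta_def fun_eq_iff simp del: upt_Suc)
  then show ?case
    by (intro bexI[of _ 1] free_alg_closed')
next
  case (step i u)
  then obtain p where p: "p \<in> carrier (free_alg {1..<n})" "H_op p (delta [1..<Suc n]) = delta u"
    by blast
  \<comment> \<open>This is \<open>G_delta\<close> solved for the vector of \<open>sw i u\<close>,
    which uses that \<open>b\<close> is invertible.\<close>
  let ?q = "fscale (1 / b) (fvar i * p - fscale (cf i u) p)"
  have "H_op ?q (delta [1..<Suc n]) w = delta (sw i u) w" for w
    unfolding poly_op_linear poly_op_mult p(2) poly_op_fvar G_delta[OF step(1,2)] using b by simp
  then have "H_op ?q (delta [1..<Suc n]) = delta (sw i u)"
    by (rule ext)
  moreover have "?q \<in> carrier (free_alg {1..<n})"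
    by (intro free_alg_closed' fvar_in_free_alg p step)
  ultimately show ?case
    by blast
qed

end


section \<open>Normal words\<close>

text \<open>Words in the generators of the Hecke algebra are rewritten to the normal words
  \<open>(1)(2 1)(3 2 1) \<dots>\<close>, in which every descending run may be cut off on the right. A predicate
  \<open>M\<close> on words stands for membership in a subspace that contains the relations.\<close>

definition run :: "nat \<Rightarrow> nat \<Rightarrow> nat list" where
  "run n j = rev [j..<Suc n]"

text \<open>The choice \<open>j = Suc n\<close> is the empty run, so this stage offers n + 1 choices
  and the list for \<open>n\<close> has n! entries.\<close>

primrec normal_words :: "nat \<Rightarrow> nat list list" where
  "normal_words 0 = [[]]"
| "normal_words (Suc n) = concat (map (\<lambda>j. map (\<lambda>x. x @ run n j) (normal_words n)) [1..<Suc (Suc n)])"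

lemma length_normal_words: "length (normal_words n) = fact n"
proof (induction n)
  case (Suc n)
  then show ?case
    by (simp add: length_concat comp_def sum_list_triv del: upt_Suc)
qed simp

definition rewrite_closed :: "(nat list \<Rightarrow> bool) \<Rightarrow> bool" where
  "rewrite_closed M \<longleftrightarrow> (\<forall>x i y. M (x @ i # y) \<longrightarrow> M (x @ y) \<longrightarrow> M (x @ i # i # y)) \<and>
     (\<forall>x i j y. \<bar>int i - int j\<bar> > 1 \<longrightarrow> M (x @ i # j # y) \<longrightarrow> M (x @ j # i # y)) \<and>
     (\<forall>x i y. M (x @ Suc i # i # Suc i # y) \<longrightarrow> M (x @ i # y) \<longrightarrow> M (x @ Suc i # y) \<longrightarrow>
       M (x @ i # Suc i # i # y)) \<and>
     (\<forall>x i y. M (x @ i # Suc i # i # y) \<longrightarrow> M (x @ i # y) \<longrightarrow> M (x @ Suc i # y) \<longrightarrow>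
       M (x @ Suc i # i # Suc i # y))"

lemma rewrite_closedD:
  assumes "rewrite_closed M"
  shows "M (x @ i # y) \<Longrightarrow> M (x @ y) \<Longrightarrow> M (x @ i # i # y)"
    and "\<bar>int i - int j\<bar> > 1 \<Longrightarrow> M (x @ i # j # y) \<Longrightarrow> M (x @ j # i # y)"
    and "M (x @ i # Suc i # i # y) \<Longrightarrow> M (x @ i # y) \<Longrightarrow> M (x @ Suc i # y) \<Longrightarrow>
      M (x @ Suc i # i # Suc i # y)"
  using assms unfolding rewrite_closed_def by blast+

lemma rewrite_closed_append:
  assumes "rewrite_closed M"
  shows "rewrite_closed (\<lambda>x. M (x @ y))"
  using assms unfolding rewrite_closed_def append_assoc append_Cons by blast

lemma rewrite_commute_left:
  assumes M: "rewrite_closed M" and far: "\<And>j. j \<in> set r \<Longrightarrow> \<bar>int i - int j\<bar> > 1"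
    and "M (x @ i # r @ y)"
  shows "M (x @ r @ i # y)"
  using far assms(3)
proof (induction r arbitrary: x)
  case (Cons j r)
  have "M ((x @ [j]) @ i # r @ y)"
    using rewrite_closedD(2)[OF M, of i j x "r @ y"] Cons.prems by simp
  from Cons.IH[OF _ this] show ?case
    using Cons.prems(1) by simp
qed simp

lemma rewrite_commute_words:
  assumes M: "rewrite_closed M" and far: "\<And>i j. i \<in> set s \<Longrightarrow> j \<in> set r \<Longrightarrow> \<bar>int i - int j\<bar> > 1"
    and "M (x @ s @ r @ y)"
  shows "M (x @ r @ s @ y)"
  using far assms(3)
proof (induction s arbitrary: y rule: rev_induct)
  case (snoc i s)
  have "M ((x @ s) @ r @ i # y)"
    using rewrite_commute_left[OF M, of r i "x @ s" y] snoc.prems by simp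
  then show ?case
    using snoc.IH[of "i # y"] snoc.prems(1) by simp
qed simp

lemma run_split:
  assumes "j \<le> k" "k \<le> Suc n"
  shows "run n j = run n k @ rev [j..<k]"
proof -
  have "[j..<Suc n] = [j..<k] @ [k..<Suc n]"
    using assms by (metis le_Suc_ex upt_add_eq_append)
  then show ?thesis
    by (simp only: run_def rev_append)
qed

lemma run_snoc: "j \<le> n \<Longrightarrow> run n j = run n (Suc j) @ [j]"
  using run_split[of j "Suc j" n] by simp

text \<open>A letter \<open>i\<close> arrives on the right of the run. It extends the run, or is
  reduced by the quadratic relation, or moves through the run into the prefix: unchanged if it is
  far below \<open>j\<close>, and lowered by 1 if \<open>i > j\<close>.\<close>

lemma rewrite_run:
  assumes M: "rewrite_closed M"
    and base: "\<And>x j. x \<in> lists {1..<n} \<Longrightarrow> 1 \<le> j \<Longrightarrow> j \<le> Suc n \<Longrightarrow> M (x @ run n j)"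
  shows "x \<in> lists {1..<n} \<Longrightarrow> 1 \<le> j \<Longrightarrow> j \<le> Suc n \<Longrightarrow> w \<in> lists {1..<Suc n} \<Longrightarrow> M (x @ run n j @ w)"
proof (induction w arbitrary: x j)
  case Nil
  then show ?case
    using base by simp
next
  case (Cons i w)
  have i: "1 \<le> i" "i \<le> n" and w: "w \<in> lists {1..<Suc n}"
    using Cons.prems(4) by auto
  have IH: "M (x' @ run n j' @ w)" if "x' \<in> lists {1..<n}" "1 \<le> j'" "j' \<le> Suc n" for x' j'
    by (rule Cons.IH[OF that w])
  consider "Suc i < j" | "Suc i = j" | "i = j" | "j < i"
    by linarith
  then show ?case
  proof cases
    case 1
    then have "x @ [i] \<in> lists {1..<n}"
      using i Cons.prems(1,3) by auto
    then have "M (x @ i # run n j @ w)"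
      using IH[of "x @ [i]" j] Cons.prems by simp
    moreover have "\<bar>int i - int k\<bar> > 1" if "k \<in> set (run n j)" for k
      using that 1 by (auto simp: run_def simp del: upt_Suc)
    ultimately show ?thesis
      using rewrite_commute_left[OF M, of "run n j" i x w] by simp
  next
    case 2
    then show ?thesis
      using IH[OF Cons.prems(1), of i] i run_snoc[of i n] by simp
  next
    case 3
    have "M (x @ run n j @ w)" "M (x @ run n (Suc j) @ w)"
      using IH[OF Cons.prems(1), of j] IH[OF Cons.prems(1), of "Suc j"] Cons.prems(2) i 3 by simp_all
    then show ?thesis
      using rewrite_closedD(1)[OF M, of "x @ run n (Suc j)" j w] run_snoc[of j n] i 3 by simp
  next
    case 4
    then obtain k where k: "i = Suc k" "1 \<le> k" "j \<le> k"
      using Cons.prems(2) by (cases i) auto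
    let ?A = "run n (Suc i)" and ?B = "rev [j..<k]"
    have run: "run n j = ?A @ i # k # ?B" "run n i = ?A @ [i]"
    proof -
      show "run n i = ?A @ [i]"
        by (rule run_snoc[OF i(2)])
      have "run n j = run n (Suc i) @ rev [j..<Suc i]"
        using 4 i by (intro run_split) auto
      also have "rev [j..<Suc i] = i # k # ?B"
        using k by simp
      finally show "run n j = ?A @ i # k # ?B" .
    qed
    have A: "a > i" if "a \<in> set ?A" for a
      using that by (auto simp: run_def simp del: upt_Suc)
    have B: "b < k" if "b \<in> set ?B" for b
      using that by auto
    have B_lists: "x @ ?B \<in> lists {1..<n}" "x @ k # ?B \<in> lists {1..<n}" "x @ [k] \<in> lists {1..<n}"
      using Cons.prems(1,2) i k by auto
    have far: "\<bar>int b - int a\<bar> > 1" if "b \<in> set ?B" "a \<in> set (?A @ [i])" for a b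
      using A[of a] B[of b] that k(1) by auto
    have far_k: "\<bar>int k - int a\<bar> > 1" if "a \<in> set ?A" for a
      using A[OF that] k(1) by simp
    have 1: "M ((x @ ?A) @ k # Suc k # k # ?B @ w)"
      using rewrite_commute_left[OF M, of ?A k x "i # k # ?B @ w", OF far_k] IH[OF B_lists(3) Cons.prems(2,3)]
      by (simp add: run(1) k(1))
    have 2: "M ((x @ ?A) @ Suc k # ?B @ w)"
      using rewrite_commute_words[OF M, of ?B "?A @ [i]" x w, OF far] IH[OF B_lists(1) i(1)] i(2) by (simp add: run(2)[unfolded k(1)] k(1))
    have "M (x @ k # ?A @ ?B @ w)"
      using IH[OF B_lists(2), of "Suc i"] i(2)
        rewrite_commute_words[OF M, of ?B ?A "x @ [k]" w] far by simp
    then have 3: "M ((x @ ?A) @ k # ?B @ w)"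
      using rewrite_commute_left[OF M, of ?A k x "?B @ w", OF far_k] by simp
    have "M ((x @ ?A) @ Suc k # k # Suc k # ?B @ w)"
      by (rule rewrite_closedD(3)[OF M 1 3 2])
    then have "M ((x @ ?A @ [Suc k, k]) @ ?B @ Suc k # w)"
      using rewrite_commute_words[OF M, of "[Suc k]" ?B "x @ ?A @ [Suc k, k]" w] far k(1)
      by (simp add: abs_minus_commute)
    then show ?thesis
      by (simp add: run(1) k(1))
  qed
qed

text \<open>The induction hypothesis, applied with a fixed run as suffix, admits arbitrary prefixes;
  \<open>rewrite_run\<close> then appends arbitrary letters, starting from the empty run
  \<open>run n (Suc n)\<close>.\<close>

theorem normal_words_suffice:
  assumes "rewrite_closed M" "\<And>x. x \<in> set (normal_words n) \<Longrightarrow> M x" "w \<in> lists {1..<n}"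
  shows "M w"
  using assms
proof (induction n arbitrary: M w)
  case (Suc n)
  have base: "M (x @ run n j)" if "x \<in> lists {1..<n}" "1 \<le> j" "j \<le> Suc n" for x j
  proof (rule Suc.IH[OF rewrite_closed_append[OF Suc.prems(1)] _ that(1)])
    show "M (y @ run n j)" if "y \<in> set (normal_words n)" for y
      using that \<open>1 \<le> j\<close> \<open>j \<le> Suc n\<close> by (intro Suc.prems(2)) (auto simp del: upt_Suc)
  qed
  show ?case
    using rewrite_run[OF Suc.prems(1) base, of "[]" "Suc n" w] Suc.prems(3) by (simp add: run_def)
qed simp


section \<open>The presentation\<close>

lemma card_perms: "finite (perms n)" "card (perms n) = fact n"
proof -
  have "perms n = permutations_of_set {1..n}"
    by (auto simp: perms_def permutations_of_set_def)
  then show "finite (perms n)" "card (perms n) = fact n"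
    by simp_all
qed

lemma w0_perms: "[1..<Suc n] \<in> perms n"
  by (auto simp: perms_def)

lemma proj_delta: "u \<in> perms n \<Longrightarrow> proj n (delta u) = delta u"
  by (auto simp: proj_def delta_def)

lemma corner_mat_eqI:
  assumes "\<And>w. w \<in> perms n \<Longrightarrow> U_op p (delta [1..<Suc n]) w = U_op q (delta [1..<Suc n]) w"
  shows "corner_mat n p = corner_mat n q"
proof -
  have eq: "U_op p (delta u) w = U_op q (delta u) w" if "u \<in> perms n" "w \<in> perms n" for u w
    using U_op_determined[OF w0_perms _ that, of "p - q"] assms by simp
  have "proj n (U_op p (proj n (delta u))) w = proj n (U_op q (proj n (delta u))) w" for u w
  proof (cases "u \<in> perms n")
    case True
    then show ?thesis
      by (simp add: proj_delta) (simp add: proj_def eq)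
  next
    case False
    then have "proj n (delta u) = (\<lambda>w. 0)"
      by (auto simp: proj_def delta_def)
    then show ?thesis
      by (simp add: linop_zero[OF U_ops.linop_poly_op])
  qed
  then show ?thesis
    by (simp add: corner_mat_def word_mat_eq_iff)
qed

lemma corner_mat_closed:
  "corner_mat n p + corner_mat n q = corner_mat n (p + q)"
  "c \<cdot>\<^sub>m corner_mat n p = corner_mat n (fscale c p)"
  "word_mat n n (proj n) = corner_mat n 1"
proof -
  have add: "proj n (\<lambda>w. f w + g w) = (\<lambda>w. proj n f w + proj n g w)"
    and cmult: "proj n (\<lambda>w. c * f w) = (\<lambda>w. c * proj n f w)" for f g c
    by (auto simp: proj_def)
  have "U_op (p + q) f = (\<lambda>w. U_op p f w + U_op q f w)" "U_op (fscale c p) f = (\<lambda>w. c * U_op p f w)" for f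
    by (simp_all add: fun_eq_iff)
  then show "corner_mat n p + corner_mat n q = corner_mat n (p + q)"
      "c \<cdot>\<^sub>m corner_mat n p = corner_mat n (fscale c p)"
    by (simp_all add: corner_mat_def add cmult word_mat_linear)
  have "U_op 1 f = f" for f
    by (simp add: fun_eq_iff)
  then show "word_mat n n (proj n) = corner_mat n 1"
    by (simp add: corner_mat_def)
qed

text \<open>The idempotent between the two factors has the representative \<open>q_omega n\<close>,
  so the product again comes from a single polynomial in the generators of U.\<close>

lemma corner_mat_mult:
  assumes p: "p \<in> carrier (free_alg (ugens n))" and q: "q \<in> carrier (free_alg (ugens n))"
  shows "corner_mat n p * corner_mat n q = corner_mat n (p * q_omega n * q)"
proof -
  note loc = local_op_comp[OF local_op_proj local_U_op[OF p]]
  have "corner_mat n p * corner_mat n q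
      = word_mat n n (\<lambda>f. proj n (U_op p (proj n (proj n (U_op q (proj n f))))))"
    unfolding corner_mat_def by (rule word_mat_comp[symmetric], rule local_op_comp[OF loc local_op_proj])
  also have "\<dots> = corner_mat n (p * q_omega n * q)"
    unfolding corner_mat_def word_mat_eq_iff
  proof (intro ballI)
    fix u w assume w: "w \<in> words n n"
    \<comment> \<open>\<open>q_omega n\<close> is known to act as \<open>proj n\<close> only at
      words in \<open>words n n\<close>, so it is exchanged by locality and not by equality of
      operators.\<close>
    have "proj n (U_op p (proj n g)) w = proj n (U_op p (U_op (q_omega n) g)) w" for g
      by (rule local_op_cong[OF loc _ w]) (simp add: U_op_q_omega)
    then show "proj n (U_op p (proj n (proj n (U_op q (proj n (delta u)))))) w
        = proj n (U_op (p * q_omega n * q) (proj n (delta u))) w"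
      by (simp add: U_op_mult)
  qed
  finally show ?thesis .
qed

lemma corner_Schur_closed:
  "x \<in> carrier (corner_Schur n) \<Longrightarrow> y \<in> carrier (corner_Schur n) \<Longrightarrow> x + y \<in> carrier (corner_Schur n)"
  "x \<in> carrier (corner_Schur n) \<Longrightarrow> y \<in> carrier (corner_Schur n) \<Longrightarrow> x * y \<in> carrier (corner_Schur n)"
  "x \<in> carrier (corner_Schur n) \<Longrightarrow> c \<cdot>\<^sub>m x \<in> carrier (corner_Schur n)"
  "word_mat n n (proj n) \<in> carrier (corner_Schur n)"
  unfolding corner_Schur_carrier corner_mat_closed(3)
  by (auto simp: corner_mat_closed(1,2) corner_mat_mult simp del: free_alg_simps(1)
    intro!: imageI free_alg_closed' wt_elem_omega(2))

lemma corner_Schur_minus: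
  assumes "word_mat n n X \<in> carrier (corner_Schur n)" "word_mat n n Y \<in> carrier (corner_Schur n)"
  shows "word_mat n n X \<ominus>\<^bsub>corner_Schur n\<^esub> word_mat n n Y = word_mat n n (\<lambda>f w. X f w - Y f w)"
proof -
  have dim: "x \<in> carrier_mat (n ^ n) (n ^ n)" if "x \<in> carrier (corner_Schur n)" for x
    using that unfolding corner_Schur_carrier corner_mat_def by auto
  have neg: "word_mat n n (\<lambda>f w. - 1 * Y f w) \<in> carrier (corner_Schur n)"
    using corner_Schur_closed(3)[OF assms(2)] by (simp only: word_mat_linear)
  have inv: "word_mat n n Y + word_mat n n (\<lambda>f w. - 1 * Y f w) = 0\<^sub>m (n ^ n) (n ^ n)"
    by (rule eq_matI) simp_all
  have "\<ominus>\<^bsub>corner_Schur n\<^esub> word_mat n n Y = word_mat n n (\<lambda>f w. - 1 * Y f w)"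
    unfolding a_inv_def m_inv_def
  proof (rule the_equality, goal_cases)
    case 1
    show ?case
      using neg inv by (simp add: comm_add_mat[of _ "n ^ n" "n ^ n"])
  next
    case (2 x)
    then have x: "x \<in> carrier_mat (n ^ n) (n ^ n)" and "word_mat n n Y + x = 0\<^sub>m (n ^ n) (n ^ n)"
      using dim by simp_all
    then show ?case
    proof (intro eq_matI)
      fix i j assume "i < dim_row (word_mat n n (\<lambda>f w. - 1 * Y f w))"
        "j < dim_col (word_mat n n (\<lambda>f w. - 1 * Y f w))"
      then show "x $$ (i, j) = word_mat n n (\<lambda>f w. - 1 * Y f w) $$ (i, j)"
        using arg_cong[OF \<open>word_mat n n Y + x = 0\<^sub>m (n ^ n) (n ^ n)\<close>, of "\<lambda>A. A $$ (i, j)"] x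
        by (simp add: eq_neg_iff_add_eq_0 add.commute)
    qed (use x in simp_all)
  qed
  then show ?thesis
    unfolding a_minus_def by (simp add: word_mat_linear[symmetric])
qed

section \<open>Normal words span modulo the relations\<close>

context hecke_op
begin

definition rels :: "(nat list \<Rightarrow>\<^sub>0 ratv) set" where
  "rels = {fvar i * fvar i - fscale (c1 + c2) (fvar i) - fscale (b * b - c1 * c2) 1 | i. i \<in> {1..<n}}
   \<union> {fvar i * fvar j - fvar j * fvar i
      | i j. i \<in> {1..<n} \<and> j \<in> {1..<n} \<and> \<bar>int i - int j\<bar> > 1}
   \<union> {fvar i * fvar (i + 1) * fvar i - fvar (i + 1) * fvar i * fvar (i + 1)
        - fscale (c1 * c2) (fvar i - fvar (i + 1))
      | i. i \<in> {1..<n} \<and> i + 1 \<in> {1..<n}}"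

lemma rels_closed: "rels \<subseteq> carrier (free_alg {1..<n})"
  unfolding rels_def
  by (intro subsetI, elim UnE CollectE exE conjE; hypsubst;
      intro free_alg_closed' fvar_in_free_alg; assumption)

abbreviation rels_ideal :: "(nat list \<Rightarrow>\<^sub>0 ratv) set" where
  "rels_ideal \<equiv> genideal (free_alg {1..<n}) rels"

lemma rels_free_ideal: "free_ideal {1..<n} rels_ideal"
  by (rule free_ideal_genideal[OF rels_closed])

lemmas ideal_closed = free_ideal.ideal_closed[OF rels_free_ideal]

lemma rels_in_ideal: "r \<in> rels \<Longrightarrow> r \<in> rels_ideal"
  using ring.genideal_self[OF free_alg_ring rels_closed] by blast

lemma H_op_fvar: "H_op (fvar i) = G i"
  by (intro ext poly_op_fvar)

lemma H_op_mult: "H_op (p * q) f = H_op p (H_op q f)"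
  by (intro ext poly_op_mult)

lemma H_op_rels:
  assumes "r \<in> rels"
  shows "H_op r f w = 0"
  using assms unfolding rels_def
proof (elim UnE CollectE exE conjE)
  fix i assume i: "i \<in> {1..<n}"
    and r: "r = fvar i * fvar i - fscale (c1 + c2) (fvar i) - fscale (b * b - c1 * c2) 1"
  show ?thesis
    unfolding r poly_op_linear H_op_mult H_op_fvar poly_op_one G_square[OF i] by simp
next
  fix i j assume i: "i \<in> {1..<n}" and j: "j \<in> {1..<n}" and far: "\<bar>int i - int j\<bar> > 1"
    and r: "r = fvar i * fvar j - fvar j * fvar i"
  have "G i (G j f) w = G j (G i f) w"
    by (rule G_commute[OF i j]) (use far in auto)
  then show ?thesis
    unfolding r poly_op_linear H_op_mult H_op_fvar by simp
next
  fix i assume i: "i \<in> {1..<n}" and j: "i + 1 \<in> {1..<n}"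
    and r: "r = fvar i * fvar (i + 1) * fvar i - fvar (i + 1) * fvar i * fvar (i + 1)
        - fscale (c1 * c2) (fvar i - fvar (i + 1))"
  show ?thesis
    unfolding r poly_op_linear H_op_mult H_op_fvar using G_braid[OF i, of f w] j by simp
qed

lemma H_op_ideal: "p \<in> rels_ideal \<Longrightarrow> H_op p f w = 0"
  by (rule poly_op_eq_0_on_genideal[where R = rels and Y = "{1..<n}"])
    (use rels_closed H_op_rels in blast)+

lemma ideal_context:
  assumes "r \<in> rels" "x \<in> lists {1..<n}" "y \<in> lists {1..<n}"
  shows "Poly_Mapping.single x 1 * r * Poly_Mapping.single y 1 \<in> rels_ideal"
  by (rule ideal_closed(6)[OF ideal_closed(5)[OF rels_in_ideal[OF assms(1)]]])
    (use assms(2,3) in simp_all)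

text \<open>Coefficients are attached to positions in the list, which makes them a vector of length
  n! for the matrix argument in \<open>H_op_kernel\<close>.\<close>

definition normal_span :: "(nat list \<Rightarrow>\<^sub>0 ratv) set" where
  "normal_span = {p. \<exists>c. p - (\<Sum>j<fact n. Poly_Mapping.single (normal_words n ! j) (c j)) \<in> rels_ideal}"

lemma normal_span_zero: "0 \<in> normal_span"
  unfolding normal_span_def
  using ideal_closed(1) by (intro CollectI exI[of _ "\<lambda>_. 0"]) simp

lemma normal_span_add:
  assumes "p \<in> normal_span" "q \<in> normal_span"
  shows "p + q \<in> normal_span"
proof -
  obtain c d where "p - (\<Sum>j<fact n. Poly_Mapping.single (normal_words n ! j) (c j)) \<in> rels_ideal"
      "q - (\<Sum>j<fact n. Poly_Mapping.single (normal_words n ! j) (d j)) \<in> rels_ideal"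
    using assms by (auto simp: normal_span_def)
  from ideal_closed(2)[OF this]
  have "p + q - (\<Sum>j<fact n. Poly_Mapping.single (normal_words n ! j) (c j + d j)) \<in> rels_ideal"
    by (simp add: single_add sum.distrib algebra_simps)
  then show ?thesis
    unfolding normal_span_def by - (rule CollectI, erule exI)
qed

lemma normal_span_fscale:
  assumes "p \<in> normal_span"
  shows "fscale a p \<in> normal_span"
proof -
  obtain c where "p - (\<Sum>j<fact n. Poly_Mapping.single (normal_words n ! j) (c j)) \<in> rels_ideal"
    using assms by (auto simp: normal_span_def)
  from ideal_closed(7)[OF this, of a]
  have "fscale a p - (\<Sum>j<fact n. Poly_Mapping.single (normal_words n ! j) (a * c j)) \<in> rels_ideal"
    by (simp add: fscale_eq_mult right_diff_distrib sum_distrib_left mult_single)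
  then show ?thesis
    unfolding normal_span_def by - (rule CollectI, erule exI)
qed

lemma normal_span_cong:
  assumes "p - q \<in> rels_ideal" "q \<in> normal_span"
  shows "p \<in> normal_span"
proof -
  obtain c where "q - (\<Sum>j<fact n. Poly_Mapping.single (normal_words n ! j) (c j)) \<in> rels_ideal"
    using assms by (auto simp: normal_span_def)
  from ideal_closed(2)[OF assms(1) this]
  have "p - (\<Sum>j<fact n. Poly_Mapping.single (normal_words n ! j) (c j)) \<in> rels_ideal"
    by simp
  then show ?thesis
    unfolding normal_span_def by - (rule CollectI, erule exI)
qed

abbreviation wd :: "nat list \<Rightarrow> (nat list \<Rightarrow>\<^sub>0 ratv)" where
  "wd x \<equiv> Poly_Mapping.single x 1"

lemma wd_mult: "wd x * wd y = wd (x @ y)"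
  by (simp add: mult_single)

lemma wd_fscale: "wd x * fscale a p = fscale a (wd x * p)" "fscale a p * q = fscale a (p * q)"
  by (simp_all add: fscale_eq_mult mult.assoc[symmetric] mult_single)

lemma wd_Nil: "1 = wd []"
  using single_one[where ?'a = "nat list" and ?'b = ratv] by simp

lemma normal_span_diff:
  assumes "p \<in> normal_span" "q \<in> normal_span"
  shows "p - q \<in> normal_span"
proof -
  have "fscale (- 1) q = - q"
    by (rule poly_mapping_eqI) (simp add: map.rep_eq when_def)
  then show ?thesis
    using normal_span_add[OF assms(1) normal_span_fscale[OF assms(2), of "- 1"]] by simp
qed

lemmas wd_expand = left_diff_distrib right_diff_distrib wd_fscale mult.assoc[symmetric] wd_mult
  append.simps append_assoc

lemma normal_span_square:
  assumes "i \<in> {1..<n}" "x \<in> lists {1..<n}" "y \<in> lists {1..<n}"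
    and "wd (x @ i # y) \<in> normal_span" "wd (x @ y) \<in> normal_span"
  shows "wd (x @ i # i # y) \<in> normal_span"
proof (rule normal_span_cong)
  have "fvar i * fvar i - fscale (c1 + c2) (fvar i) - fscale (b * b - c1 * c2) (wd []) \<in> rels"
    unfolding rels_def wd_Nil[symmetric] using assms(1) by blast
  moreover have "wd x * (fvar i * fvar i - fscale s (fvar i) - fscale t (wd [])) * wd y
      = wd (x @ i # i # y) - (fscale s (wd (x @ i # y)) + fscale t (wd (x @ y)))" for s t
    unfolding wd_expand by (simp only: diff_diff_eq)
  ultimately show "wd (x @ i # i # y) -
      (fscale (c1 + c2) (wd (x @ i # y)) + fscale (b * b - c1 * c2) (wd (x @ y))) \<in> rels_ideal"
    using ideal_context[OF _ assms(2,3)] by metis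
qed (intro normal_span_add normal_span_fscale assms)

lemma normal_span_commute:
  assumes "i \<in> {1..<n}" "j \<in> {1..<n}" "\<bar>int i - int j\<bar> > 1" "x \<in> lists {1..<n}" "y \<in> lists {1..<n}"
    and "wd (x @ i # j # y) \<in> normal_span"
  shows "wd (x @ j # i # y) \<in> normal_span"
proof (rule normal_span_cong)
  have "fvar j * fvar i - fvar i * fvar j \<in> rels"
    unfolding rels_def using assms(1-3) abs_minus_commute[of "int i" "int j"] by simp blast
  from ideal_context[OF this assms(4,5)]
  show "wd (x @ j # i # y) - wd (x @ i # j # y) \<in> rels_ideal"
    unfolding wd_expand .
qed (rule assms)

lemma normal_span_braid:
  assumes "i \<in> {1..<n}" "Suc i \<in> {1..<n}" "x \<in> lists {1..<n}" "y \<in> lists {1..<n}"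
    and "wd (x @ i # y) \<in> normal_span" "wd (x @ Suc i # y) \<in> normal_span"
  shows "wd (x @ i # Suc i # i # y) \<in> normal_span \<longleftrightarrow> wd (x @ Suc i # i # Suc i # y) \<in> normal_span"
proof -
  let ?d = "fscale (c1 * c2) (wd (x @ i # y) - wd (x @ Suc i # y))"
  have "fvar i * fvar (i + 1) * fvar i - fvar (i + 1) * fvar i * fvar (i + 1)
      - fscale (c1 * c2) (fvar i - fvar (i + 1)) \<in> rels"
    unfolding rels_def using assms(1,2) by (intro UnI2 CollectI exI[of _ i]) simp
  from ideal_context[OF this assms(3,4)]
  have r: "wd (x @ i # Suc i # i # y) - wd (x @ Suc i # i # Suc i # y) - ?d \<in> rels_ideal"
    unfolding wd_expand Suc_eq_plus1[symmetric] .
  have d: "?d \<in> normal_span"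
    by (intro normal_span_fscale normal_span_diff assms)
  show ?thesis
  proof
    assume "wd (x @ i # Suc i # i # y) \<in> normal_span"
    then show "wd (x @ Suc i # i # Suc i # y) \<in> normal_span"
      using normal_span_cong[of "wd (x @ Suc i # i # Suc i # y)" "wd (x @ i # Suc i # i # y) - ?d"]
        ideal_closed(3)[OF r] normal_span_diff d by (simp add: algebra_simps)
  next
    assume "wd (x @ Suc i # i # Suc i # y) \<in> normal_span"
    then show "wd (x @ i # Suc i # i # y) \<in> normal_span"
      using normal_span_cong[of "wd (x @ i # Suc i # i # y)" "wd (x @ Suc i # i # Suc i # y) + ?d"]
        r normal_span_add d by (simp add: diff_diff_eq)
  qed
qed

text \<open>Relations exist only for letters in \<open>{1..<n}\<close>, so this restriction is part
  of the predicate. It passes from conclusion to premises because each rewriting step keeps every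
  letter of its premises.\<close>

lemma rewrite_closed_normal_span:
  "rewrite_closed (\<lambda>w. w \<in> lists {1..<n} \<longrightarrow> wd w \<in> normal_span)"
  unfolding rewrite_closed_def append_in_lists_conv Cons_in_lists_iff
  using normal_span_square normal_span_commute normal_span_braid by blast

lemma normal_span_all:
  assumes "p \<in> carrier (free_alg {1..<n})"
  shows "p \<in> normal_span"
proof -
  have normal: "wd w \<in> normal_span" if "w \<in> set (normal_words n)" for w
  proof -
    obtain k where k: "k < fact n" "w = normal_words n ! k"
      using \<open>w \<in> set (normal_words n)\<close> by (auto simp: in_set_conv_nth length_normal_words)
    have "(\<Sum>j<fact n. Poly_Mapping.single (normal_words n ! j) (if j = k then 1 else 0)) = wd w"
      using k by (simp add: if_distrib[of "Poly_Mapping.single _"] cong: if_cong)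
    then show ?thesis
      unfolding normal_span_def by (intro CollectI exI[of _ "\<lambda>j. if j = k then 1 else 0"]) (use ideal_closed(1) in simp)
  qed
  have word: "wd w \<in> normal_span" if "w \<in> lists {1..<n}" for w
    using normal_words_suffice[OF rewrite_closed_normal_span _ that] normal that by blast
  have "Poly_Mapping.keys p \<subseteq> lists {1..<n}"
    using assms by simp
  then show ?thesis
  proof (induction p rule: poly_mapping_keys_induct)
    case (add w c q)
    have "fscale c (wd w) \<in> normal_span"
      by (rule normal_span_fscale[OF word[OF add(1)]])
    then show ?case
      using normal_span_add[OF _ add(3)] by (simp add: fscale_eq_mult mult_single)
  qed (rule normal_span_zero)
qed

lemma H_op_normal_sum:
  assumes "p - (\<Sum>j<fact n. Poly_Mapping.single (normal_words n ! j) (c j)) \<in> rels_ideal"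
  shows "H_op p f w = (\<Sum>j<fact n. c j * H_op (wd (normal_words n ! j)) f w)"
proof -
  have sum: "H_op (\<Sum>j\<in>J. Poly_Mapping.single (normal_words n ! j) (c j)) f w
      = (\<Sum>j\<in>J. c j * H_op (wd (normal_words n ! j)) f w)" for J
    by (induction J rule: infinite_finite_induct) simp_all
  show ?thesis
    using H_op_ideal[OF assms, of f w] by (simp only: poly_op_linear sum right_minus_eq)
qed

text \<open>The \<open>n!\<close> normal words span a space of operators that contains the \<open>n!\<close> basis vectors of
  the \<open>\<omega>\<close> weight space in its image of one vector, so they are linearly independent.\<close>

lemma H_op_kernel:
  assumes b: "b \<noteq> 0" and p: "p \<in> carrier (free_alg {1..<n})"
    and zero: "\<And>w. w \<in> perms n \<Longrightarrow> H_op p (delta [1..<Suc n]) w = 0"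
  shows "p \<in> rels_ideal"
proof -
  let ?w0 = "[1..<Suc n]" and ?N = "fact n :: nat"
  let ?T = "\<lambda>j. H_op (wd (normal_words n ! j)) (delta ?w0)"
  obtain us where us: "set us = perms n" "distinct us"
    using finite_distinct_list[OF card_perms(1)] by blast
  have len: "length us = ?N"
    using us card_perms(2) distinct_card by metis
  have us_perms: "us ! i \<in> perms n" if "i < ?N" for i
    using that nth_mem[of i us] by (simp only: us(1) len)
  have "\<exists>d. \<forall>w. delta (us ! k) w = (\<Sum>j<?N. d j * ?T j w)" if k: "k < ?N" for k
  proof -
    obtain q where q: "q \<in> carrier (free_alg {1..<n})" "H_op q (delta ?w0) = delta (us ! k)"
      using delta_reached[OF b us_perms[OF k]] by blast
    obtain d where "q - (\<Sum>j<?N. Poly_Mapping.single (normal_words n ! j) (d j)) \<in> rels_ideal"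
      using normal_span_all[OF q(1)] by (auto simp: normal_span_def)
    from H_op_normal_sum[OF this, of "delta ?w0"] show ?thesis
      unfolding q(2) by blast
  qed
  then have "\<forall>k\<in>{..<?N}. \<exists>d. \<forall>w. delta (us ! k) w = (\<Sum>j<?N. d j * ?T j w)"
    by simp
  then obtain d where "\<forall>k\<in>{..<?N}. \<forall>w. delta (us ! k) w = (\<Sum>j<?N. d k j * ?T j w)"
    by (rule bchoice[THEN exE])
  then have d: "delta (us ! k) w = (\<Sum>j<?N. d k j * ?T j w)" if "k < ?N" for k w
    using that by simp
  \<comment> \<open>The columns of \<open>A\<close> are the values of the normal operators at the
    word 1 2 ... n, and \<open>B\<close> writes the basis vectors as combinations of these
    columns.\<close>
  define A where "A = mat ?N ?N (\<lambda>(i, j). ?T j (us ! i))"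
  define B where "B = mat ?N ?N (\<lambda>(j, k). d k j)"
  have AB: "A * B = 1\<^sub>m ?N"
  proof (rule eq_matI)
    fix i k assume "i < dim_row (1\<^sub>m ?N)" "k < dim_col (1\<^sub>m ?N)"
    then have ik: "i < ?N" "k < ?N"
      by simp_all
    have "(A * B) $$ (i, k) = delta (us ! k) (us ! i)"
      using ik by (simp add: A_def B_def scalar_prod_def d lessThan_atLeast0 mult.commute)
    also have "\<dots> = 1\<^sub>m ?N $$ (i, k)"
      using ik us(2) len by (simp add: delta_def nth_eq_iff_index_eq)
    finally show "(A * B) $$ (i, k) = 1\<^sub>m ?N $$ (i, k)" .
  qed (simp_all add: A_def B_def)
  have dims: "A \<in> carrier_mat ?N ?N" "B \<in> carrier_mat ?N ?N"
    by (simp_all add: A_def B_def)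
  obtain c where c: "p - (\<Sum>j<?N. Poly_Mapping.single (normal_words n ! j) (c j)) \<in> rels_ideal"
    using normal_span_all[OF p] by (auto simp: normal_span_def)
  have "A *\<^sub>v vec ?N c = 0\<^sub>v ?N"
  proof (rule eq_vecI)
    fix i assume "i < dim_vec (0\<^sub>v ?N :: ratv vec)"
    then have i: "i < ?N"
      by simp
    have "(A *\<^sub>v vec ?N c) $ i = (\<Sum>j<?N. c j * ?T j (us ! i))"
      using i by (simp add: A_def scalar_prod_def lessThan_atLeast0 mult.commute)
    also have "\<dots> = 0"
      using H_op_normal_sum[OF c, of "delta ?w0" "us ! i"] zero[OF us_perms[OF i]] by simp
    finally show "(A *\<^sub>v vec ?N c) $ i = 0\<^sub>v ?N $ i"
      using i by simp
  qed (simp add: A_def)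
  then have "(B * A) *\<^sub>v vec ?N c = 0\<^sub>v ?N"
    using dims assoc_mult_mat_vec[OF dims(2,1), of "vec ?N c"] by auto
  \<comment> \<open>The right inverse is a left inverse because \<open>A\<close> is square: there
    are as many normal words as permutations.\<close>
  then have "vec ?N c = 0\<^sub>v ?N"
    using mat_mult_left_right_inverse[OF dims AB] by simp
  then have "c j = 0" if "j < ?N" for j
    using that by (metis index_vec index_zero_vec(1))
  then have "(\<Sum>j<?N. Poly_Mapping.single (normal_words n ! j) (c j)) = 0"
    by (intro sum.neutral) simp
  with c show ?thesis
    by simp
qed

section \<open>The image of the free algebra is the corner algebra\<close>

definition H_mat :: "(nat list \<Rightarrow>\<^sub>0 ratv) \<Rightarrow> ratv mat" where
  "H_mat p = word_mat n n (H_op p)"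

lemma H_mat_fvar: "H_mat (fvar i) = word_mat n n (G i)"
  by (simp only: H_mat_def H_op_fvar)

lemma local_op_G: "local_op n n (G i)"
proof -
  have "G i f w = G i g w" if "\<forall>u\<in>words n n. f u = g u" "w \<in> words n n" for f g w
    using that perms_subset_words[of n] by (auto simp: G_def proj_def)
  then show ?thesis
    by (simp add: local_op_def linop_X)
qed

lemma H_mat_hom:
  "H_mat (p + q) = H_mat p + H_mat q"
  "H_mat (fscale c p) = c \<cdot>\<^sub>m H_mat p"
  "H_mat 1 = word_mat n n (proj n)"
  "p \<in> carrier (free_alg {1..<n}) \<Longrightarrow> H_mat (p * q) = H_mat p * H_mat q"
proof -
  have "H_op (p + q) = (\<lambda>f w. H_op p f w + H_op q f w)" "H_op (fscale c p) = (\<lambda>f w. c * H_op p f w)"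
    "H_op 1 = proj n"
    by (simp_all add: fun_eq_iff)
  then show "H_mat (p + q) = H_mat p + H_mat q" "H_mat (fscale c p) = c \<cdot>\<^sub>m H_mat p"
    "H_mat 1 = word_mat n n (proj n)"
    by (simp_all add: H_mat_def word_mat_linear)
  assume p: "p \<in> carrier (free_alg {1..<n})"
  have "local_op n n (H_op p)"
    by (rule local_poly_op[OF local_op_proj local_op_G, where Y = "{1..<n}"]) (use p in simp)
  moreover have "H_op (p * q) = (\<lambda>f. H_op p (H_op q f))"
    by (rule ext, rule H_op_mult)
  ultimately show "H_mat (p * q) = H_mat p * H_mat q"
    unfolding H_mat_def using word_mat_comp by metis
qed

text \<open>Serves for two predicates: membership in the corner algebra and membership in the
  subalgebra generated by the \<open>G i\<close>.\<close>

lemma H_mat_induct: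
  assumes p: "p \<in> carrier (free_alg {1..<n})"
    and one: "P (word_mat n n (proj n))" and gen: "\<And>i. i \<in> {1..<n} \<Longrightarrow> P (word_mat n n (G i))"
    and add: "\<And>x y. P x \<Longrightarrow> P y \<Longrightarrow> P (x + y)" and mult: "\<And>x y. P x \<Longrightarrow> P y \<Longrightarrow> P (x * y)"
    and smult: "\<And>c x. P x \<Longrightarrow> P (c \<cdot>\<^sub>m x)"
  shows "P (H_mat p)"
proof -
  have word: "P (H_mat (wd w))" if "w \<in> lists {1..<n}" for w
    using that
  proof (induction w)
    case Nil
    show ?case
      using one H_mat_hom(3) by (simp only: wd_Nil)
  next
    case (Cons i w)
    have "P (H_mat (fvar i) * H_mat (wd w))"
      unfolding H_mat_fvar by (rule mult[OF gen[OF Cons(1)] Cons(3)])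
    moreover have "(fvar i :: nat list \<Rightarrow>\<^sub>0 ratv) \<in> carrier (free_alg {1..<n})"
      using Cons(1) by (rule fvar_in_free_alg)
    moreover have "wd (i # w) = fvar i * wd w"
      by (simp add: wd_mult)
    ultimately show ?case
      by (simp only: H_mat_hom(4))
  qed
  have "H_mat 0 = 0 \<cdot>\<^sub>m H_mat 1"
    unfolding H_mat_hom(2)[symmetric] by (rule arg_cong[where f = H_mat], rule poly_mapping_eqI) simp
  then have zero: "P (H_mat 0)"
    using smult[OF one, of 0] by (simp only: H_mat_hom(3))
  have "Poly_Mapping.keys p \<subseteq> lists {1..<n}"
    using p by simp
  then show ?thesis
  proof (induction p rule: poly_mapping_keys_induct)
    case zero
    show ?case
      by (rule \<open>P (H_mat 0)\<close>)
  next
    case (add w c q)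
    have "Poly_Mapping.single w c = fscale c (wd w)"
      by (simp add: fscale_eq_mult mult_single)
    then show ?case
      using assms(4)[OF smult[OF word[OF add(1)], of c] add(3)] by (simp only: H_mat_hom(1,2))
  qed
qed

theorem presentation:
  assumes b: "b \<noteq> 0" and gen: "\<And>i. i \<in> {1..<n} \<Longrightarrow> word_mat n n (G i) \<in> carrier (corner_Schur n)"
  shows "alg_generate (corner_Schur n) ((\<lambda>i. word_mat n n (G i)) ` {1..<n}) = carrier (corner_Schur n)"
    and "\<exists>\<phi> \<in> alg_iso (presented_alg {1..<n} rels) (corner_Schur n).
      \<forall>i \<in> {1..<n}. \<phi> (presented_gen {1..<n} rels i) = word_mat n n (G i)"
proof -
  let ?w0 = "[1..<Suc n]"
  have closed: "H_mat p \<in> carrier (corner_Schur n)" if "p \<in> carrier (free_alg {1..<n})" for p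
    by (rule H_mat_induct[OF that]) (simp_all add: corner_Schur_closed gen)
  have surj: "\<exists>q \<in> carrier (free_alg {1..<n}). H_mat q = x" if x: "x \<in> carrier (corner_Schur n)" for x
  proof -
    obtain p where p: "x = corner_mat n p"
      using x by (auto simp: corner_Schur_carrier)
    have "\<forall>u\<in>perms n. \<exists>q \<in> carrier (free_alg {1..<n}). H_op q (delta ?w0) = delta u"
      using delta_reached[OF b] by blast
    then obtain r where r: "\<And>u. u \<in> perms n \<Longrightarrow> r u \<in> carrier (free_alg {1..<n})"
      "\<And>u. u \<in> perms n \<Longrightarrow> H_op (r u) (delta ?w0) = delta u"
      by metis
    \<comment> \<open>The value of the given element at 1 2 ... n. A combination of the polynomials
      \<open>r u\<close> takes the same value there.\<close>
    define g where "g = U_op p (delta ?w0)"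
    have "\<exists>q \<in> carrier (free_alg {1..<n}). \<forall>w. H_op q (delta ?w0) w = (\<Sum>u\<in>S. g u * delta u w)"
      if "finite S" "S \<subseteq> perms n" for S
      using that
    proof (induction S rule: finite_induct)
      case empty
      show ?case
        by (intro bexI[of _ 0]) simp_all
    next
      case (insert u S)
      then obtain q where q: "q \<in> carrier (free_alg {1..<n})"
        "\<And>w. H_op q (delta ?w0) w = (\<Sum>u\<in>S. g u * delta u w)"
        by auto
      have u: "u \<in> perms n"
        using insert.prems by simp
      show ?case
      proof (rule bexI)
        show "fscale (g u) (r u) + q \<in> carrier (free_alg {1..<n})"
          by (intro free_alg_closed' r u q)
        show "\<forall>w. H_op (fscale (g u) (r u) + q) (delta ?w0) w = (\<Sum>u\<in>insert u S. g u * delta u w)"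
          using insert.hyps by (simp only: poly_op_linear r(2)[OF u] q(2) sum.insert) simp
      qed
    qed
    from this[OF card_perms(1) subset_refl] obtain q where q: "q \<in> carrier (free_alg {1..<n})"
      "\<And>w. H_op q (delta ?w0) w = (\<Sum>u\<in>perms n. g u * delta u w)"
      by blast
    have val: "H_op q (delta ?w0) w = g w" if "w \<in> perms n" for w
      using that card_perms(1) by (simp only: q(2)) (simp add: delta_def if_distrib[of "(*) _"] cong: if_cong)
    \<comment> \<open>Determination by the value at one word holds for elements that come from U, so
      the image of \<open>q\<close> is first rewritten in this form.\<close>
    obtain p' where p': "H_mat q = corner_mat n p'"
      using closed[OF q(1)] by (auto simp: corner_Schur_carrier)
    have "corner_mat n p' = corner_mat n p"
    proof (rule corner_mat_eqI)
      fix w assume w: "w \<in> perms n"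
      have "H_op q (delta ?w0) w = proj n (U_op p' (proj n (delta ?w0))) w"
        using p' w w0_perms[of n] perms_subset_words[of n]
        unfolding H_mat_def corner_mat_def word_mat_eq_iff by blast
      then show "U_op p' (delta ?w0) w = U_op p (delta ?w0) w"
        using val[OF w] w w0_perms[of n] by (simp only: proj_delta g_def) (simp only: proj_def if_True)
    qed
    then show ?thesis
      using q(1) p p' by metis
  qed
  have image: "H_mat ` carrier (free_alg {1..<n}) = carrier (corner_Schur n)"
    using closed surj by blast
  have hom: "H_mat \<in> alg_hom (free_alg {1..<n}) (corner_Schur n)"
    unfolding alg_hom_def Ring.ring_hom_def
    using closed by (auto simp: H_mat_hom simp del: free_alg_simps(1))
  have ker: "H_mat p = H_mat q \<longleftrightarrow> p - q \<in> rels_ideal"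
    if "p \<in> carrier (free_alg {1..<n})" "q \<in> carrier (free_alg {1..<n})" for p q
  proof
    assume eq: "H_mat p = H_mat q"
    show "p - q \<in> rels_ideal"
    proof (rule H_op_kernel[OF b free_alg_closed'(2)[OF that]])
      fix w assume "w \<in> perms n"
      then have "H_op p (delta ?w0) w = H_op q (delta ?w0) w"
        using eq w0_perms[of n] perms_subset_words[of n]
        unfolding H_mat_def word_mat_eq_iff by blast
      then show "H_op (p - q) (delta ?w0) w = 0"
        by (simp only: poly_op_linear diff_self)
    qed
  next
    assume "p - q \<in> rels_ideal"
    from H_op_ideal[OF this] show "H_mat p = H_mat q"
      by (simp add: H_mat_def word_mat_eq_iff)
  qed
  show "\<exists>\<phi> \<in> alg_iso (presented_alg {1..<n} rels) (corner_Schur n).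
      \<forall>i \<in> {1..<n}. \<phi> (presented_gen {1..<n} rels i) = word_mat n n (G i)"
    unfolding presented_alg_def presented_gen_def
  proof (intro bexI ballI)
    show "(\<lambda>C. the_elem (H_mat ` C)) \<in> alg_iso (quot_alg (free_alg {1..<n}) rels_ideal) (corner_Schur n)"
      by (rule free_ideal.quot_alg_iso(1)[OF rels_free_ideal hom image ker])
    fix i assume "i \<in> {1..<n}"
    then show "the_elem (H_mat ` (rels_ideal +>\<^bsub>free_alg {1..<n}\<^esub> fvar i)) = word_mat n n (G i)"
      using free_ideal.quot_alg_iso(2)[OF rels_free_ideal hom image ker fvar_in_free_alg] H_mat_fvar
      by metis
  qed
  let ?S = "(\<lambda>i. word_mat n n (G i)) ` {1..<n}"
  show "alg_generate (corner_Schur n) ?S = carrier (corner_Schur n)"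
  proof (intro subset_antisym subsetI)
    fix x assume "x \<in> alg_generate (corner_Schur n) ?S"
    then show "x \<in> carrier (corner_Schur n)"
      by induction (auto simp: corner_Schur_closed gen)
  next
    fix x assume "x \<in> carrier (corner_Schur n)"
    then obtain q where q: "q \<in> carrier (free_alg {1..<n})" "x = H_mat q"
      using surj by blast
    note gens = alg_generate.intros[where A = "corner_Schur n" and S = ?S, unfolded corner_Schur_simps]
    show "x \<in> alg_generate (corner_Schur n) ?S"
      unfolding q(2)
    proof (rule H_mat_induct[OF q(1)])
      show "word_mat n n (proj n) \<in> alg_generate (corner_Schur n) ?S"
        by (rule gens(1))
      show "word_mat n n (G i) \<in> alg_generate (corner_Schur n) ?S" if "i \<in> {1..<n}" for i
        by (rule gens(2)) (rule imageI[OF that])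
    qed (erule (1) gens(3), erule (1) gens(4), erule gens(5))
  qed
qed

end

section \<open>The relations of the t_i and of the T_i as instances\<close>

lemma fscale_0: "fscale 0 p = (0 :: 'x list \<Rightarrow>\<^sub>0 'k::comm_ring_1)"
  by (rule poly_mapping_eqI) (simp add: map.rep_eq)

lemma H_rels_eq: "H_rels n = hecke_op.rels n (inverse v) v 1"
proof -
  have "inverse v + v = qint 2" "1 * 1 - inverse v * v = 0" "inverse v * v = 1"
    by (simp_all add: qint_2)
  moreover have "fscale 1 p = p" for p :: "nat list \<Rightarrow>\<^sub>0 ratv"
    by simp
  ultimately show ?thesis
    by (simp only: H_rels_def hecke_op.rels_def fscale_0 diff_zero)
qed

lemma hecke_rels_eq: "hecke_rels n = hecke_op.rels n (v ^ 2 - 1) 0 (- v)"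
proof -
  have "v ^ 2 - 1 + 0 = v ^ 2 - 1" "- v * - v - (v ^ 2 - 1) * 0 = v ^ 2" "(v ^ 2 - 1) * 0 = 0"
    by (simp_all add: power2_eq_square)
  then show ?thesis
    by (simp only: hecke_rels_def Let_def hecke_op.rels_def fscale_0 diff_zero diff_diff_eq)
qed

theorem mainTheorem9:
  fixes n :: nat
  assumes "n \<ge> 1"
  shows "(\<exists>\<phi> \<in> alg_iso (Hecke n) (corner_Schur n).
             \<forall>i \<in> {1..<n}. \<phi> (hecke_gen n i) =
               (v ^ 2 \<odot>\<^bsub>corner_Schur n\<^esub> \<one>\<^bsub>corner_Schur n\<^esub>)
                 \<ominus>\<^bsub>corner_Schur n\<^esub> (v \<odot>\<^bsub>corner_Schur n\<^esub> tgen n i))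
       \<and> tgen n ` {1..<n} \<subseteq> carrier (corner_Schur n)
       \<and> alg_generate (corner_Schur n) (tgen n ` {1..<n}) = carrier (corner_Schur n)
       \<and> (\<exists>\<psi> \<in> alg_iso (presented_alg {1..<n} (H_rels n)) (corner_Schur n).
             \<forall>i \<in> {1..<n}. \<psi> (presented_gen {1..<n} (H_rels n) i) = tgen n i)"
proof -
  interpret T_op: hecke_op n "v ^ 2 - 1" 0 "- v" .
  have t: "tgen n i = word_mat n n (t_op.G n i)" "tgen n i \<in> carrier (corner_Schur n)"
    if "i \<in> {1..<n}" for i
  proof -
    show "tgen n i = word_mat n n (t_op.G n i)"
      using tgen_opT(1)[OF that] opT_eq_G[OF that] by simp
    have "(fvar (E i) * fvar (F i) :: ugen list \<Rightarrow>\<^sub>0 ratv) \<in> carrier (free_alg (ugens n))"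
      by (intro free_alg_closed' fvar_in_free_alg) (use that in simp_all)
    then show "tgen n i \<in> carrier (corner_Schur n)"
      unfolding tgen_opT(2)[OF that] corner_Schur_carrier by (rule imageI)
  qed
  have T: "word_mat n n (T_op.G i) = (v ^ 2 \<odot>\<^bsub>corner_Schur n\<^esub> \<one>\<^bsub>corner_Schur n\<^esub>)
        \<ominus>\<^bsub>corner_Schur n\<^esub> (v \<odot>\<^bsub>corner_Schur n\<^esub> tgen n i)" (is ?eq)
      "word_mat n n (T_op.G i) \<in> carrier (corner_Schur n)"
    if i: "i \<in> {1..<n}" for i
  proof -
    \<comment> \<open>Origin of the constants of \<open>T_op\<close>: v^2 - v (1/v) = v^2 - 1 and
      v^2 - v v = 0 on the diagonal, and - v for the exchange.\<close>
    have G: "T_op.G i = (\<lambda>f w. v ^ 2 * proj n f w - v * t_op.G n i f w)"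
      unfolding T_op.G_def[abs_def] t_op.G_def T_op.cf_def t_op.cf_def proj_def
      by (auto simp: fun_eq_iff field_simps power2_eq_square)
    have carr: "word_mat n n (\<lambda>f w. v ^ 2 * proj n f w) \<in> carrier (corner_Schur n)"
        "word_mat n n (\<lambda>f w. v * t_op.G n i f w) \<in> carrier (corner_Schur n)"
      unfolding word_mat_linear t(1)[OF i, symmetric]
      by (rule corner_Schur_closed(3), rule corner_Schur_closed(4) t(2)[OF i])+
    show eq: ?eq
      unfolding G t(1)[OF i] corner_Schur_simps word_mat_linear(2)[symmetric]
      by (rule corner_Schur_minus[OF carr, symmetric])
    have "word_mat n n (T_op.G i) = word_mat n n (\<lambda>f w. v ^ 2 * proj n f w + (- v) * t_op.G n i f w)"
      by (simp add: G)
    also have "\<dots> = v ^ 2 \<cdot>\<^sub>m word_mat n n (proj n) + (- v) \<cdot>\<^sub>m tgen n i"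
      by (simp only: word_mat_linear t(1)[OF i])
    also have "\<dots> \<in> carrier (corner_Schur n)"
      by (intro corner_Schur_closed t(2)[OF i])
    finally show "word_mat n n (T_op.G i) \<in> carrier (corner_Schur n)" .
  qed
  have img: "(\<lambda>i. word_mat n n (t_op.G n i)) ` {1..<n} = tgen n ` {1..<n}"
    by (rule image_cong) (simp_all add: t(1))
  have t_carrier: "word_mat n n (t_op.G n i) \<in> carrier (corner_Schur n)" if "i \<in> {1..<n}" for i
    using t[OF that] by simp
  show ?thesis
  proof (intro conjI)
    show "\<exists>\<phi> \<in> alg_iso (Hecke n) (corner_Schur n).
             \<forall>i \<in> {1..<n}. \<phi> (hecke_gen n i) =
               (v ^ 2 \<odot>\<^bsub>corner_Schur n\<^esub> \<one>\<^bsub>corner_Schur n\<^esub>)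
                 \<ominus>\<^bsub>corner_Schur n\<^esub> (v \<odot>\<^bsub>corner_Schur n\<^esub> tgen n i)"
      using T_op.presentation(2)[OF _ T(2)] T(1)
      unfolding Hecke_def hecke_gen_def hecke_rels_eq by fastforce
    show "tgen n ` {1..<n} \<subseteq> carrier (corner_Schur n)"
      using t(2) by blast
    show "alg_generate (corner_Schur n) (tgen n ` {1..<n}) = carrier (corner_Schur n)"
      using t_op.presentation(1)[of n, OF _ t_carrier] by (simp only: img one_neq_zero not_False_eq_True)
    show "\<exists>\<psi> \<in> alg_iso (presented_alg {1..<n} (H_rels n)) (corner_Schur n).
             \<forall>i \<in> {1..<n}. \<psi> (presented_gen {1..<n} (H_rels n) i) = tgen n i"
      using t_op.presentation(2)[of n, OF _ t_carrier] t(1)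
      unfolding H_rels_eq by fastforce
  qed
qed

end
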